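(* Let $\mathcal H$ be an infinite-dimensional separable complex Hilbert space and $\mathcal K$ a separable complex Hilbert space. Let $A\in B(\mathcal H\oplus\mathcal K)$ be self-adjoint with block representation $$A=\begin{bmatrix}A_1& B\\ B^*& A_2\end{bmatrix}$$ with respect to the decomposition $\mathcal H\oplus\mathcal K$, so that $B\in B(\mathcal K,\mathcal H)$. Then $$2\,s(B)\prec_w \mathrm{Spr}^+(A).$$
   Context: $\mathbb N=\{1,2,\dots\}$, $\mathbb Z_0=\mathbb Z\setminus\{0\}$. Spectral scale: for a bounded self-adjoint operator $A$ on an infinite-dimensional separable complex Hilbert space $\mathcal L$, $\lambda(A)=(\lambda_i(A))_{i\in\mathbb Z_0}$ is defined, for $i\in\mathbb N$, by $$\lambda_i(A)=\inf_{\dim\mathcal S=i-1}\ \sup_{\psi\in\mathcal S^\perp,\|\psi\|=1}\langle A\psi,\psi\rangle,\qquad \lambda_{-i}(A)=\sup_{\dim\mathcal S=i-1}\ \inf_{\psi\in\mathcal S^\perp,\|\psi\|=1}\langle A\psi,\psi\rangle,$$ where $\mathcal S$ ranges over $(i-1)$-dimensional subspaces of $\mathcal L$. Spectral spread: $\mathrm{Spr}^+(A)=(\lambda_i(A)-\lambda_{-i}(A))_{i\in\mathbb N}$, a bounded non-negative non-increasing sequence. Generalized singular values: for a bounded operator $T$ between separable Hilbert spaces $\mathcal H_1\to\mathcal H_2$ (at least one infinite-dimensional), $s(T)=(s_i(T))_{i\in\mathbb N}$ with $s_i(T)=\lambda_i(|T|)$, $|T|=(T^*T)^{1/2}$, if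 $\mathcal H_1$ is infinite-dimensional; if $\dim\mathcal H_1=k<\infty$, then $s_1(T)\ge\dots\ge s_k(T)$ are the eigenvalues of $|T|$ counted with multiplicity and $s_i(T)=0$ for $i>k$. Submajorization: for a bounded real sequence $a=(a_i)_{i\in\mathbb M}$, $\mathbb M\in\{\mathbb N,\mathbb Z_0\}$, put $a^\downarrow_i=\lambda_i(D_a)$, $i\in\mathbb N$, where $D_a$ is the diagonal operator with diagonal $a$ on $\ell^2(\mathbb M)$; equivalently $\sum_{i=1}^k a_i^\downarrow=\sup\{\sum_{i\in F}a_i: F\subseteq\mathbb M, |F|=k\}$. Then $a\prec_w b$ means $\sum_{i=1}^k a_i^\downarrow\le\sum_{i=1}^k b_i^\downarrow$ for all $k\in\mathbb N$. *)

theory Defs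
  imports "HOL-Analysis.Analysis"
begin

section \<open>Complex Hilbert spaces\<close>

text \<open>
  A complex inner product space is a \<^class>\<open>real_inner\<close> space (which supplies norm and topology)
  with a compatible complex scalar multiplication and a complex inner product, linear in the first
  argument, whose real part is the given real inner product.
\<close>

class complex_inner = real_inner +
  fixes scaleC :: "complex \<Rightarrow> 'a \<Rightarrow> 'a" (infixr \<open>*\<^sub>C\<close> 75)
    and cinner :: "'a \<Rightarrow> 'a \<Rightarrow> complex"
  assumes scaleC_add_right: "c *\<^sub>C (x + y) = c *\<^sub>C x + c *\<^sub>C y"
    and scaleC_add_left: "(c + d) *\<^sub>C x = c *\<^sub>C x + d *\<^sub>C x"
    and scaleC_scaleC: "c *\<^sub>C d *\<^sub>C x = (c * d) *\<^sub>C x"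
    and scaleC_of_real: "complex_of_real r *\<^sub>C x = scaleR r x"
    and cinner_commute: "cinner x y = cnj (cinner y x)"
    and cinner_add_left: "cinner (x + y) z = cinner x z + cinner y z"
    and cinner_scaleC_left: "cinner (c *\<^sub>C x) y = c * cinner x y"
    and Re_cinner: "Re (cinner x y) = inner x y"

class chilbert = complex_inner + complete_space

global_interpretation complex_vector: vector_space "scaleC :: complex \<Rightarrow> 'a \<Rightarrow> 'a::complex_inner"
proof unfold_locales
  fix x :: 'a
  show "1 *\<^sub>C x = x" using scaleC_of_real[of 1 x] by simp
qed (auto simp: scaleC_add_right scaleC_add_left scaleC_scaleC)

text \<open>The Hilbert space direct sum of two spaces is their product type.\<close>

instantiation prod :: (complex_inner, complex_inner) complex_inner
begin

definition scaleC_prod_def: "c *\<^sub>C p = (c *\<^sub>C fst p, c *\<^sub>C snd p)"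

definition cinner_prod_def: "cinner p q = cinner (fst p) (fst q) + cinner (snd p) (snd q)"

instance
proof
  fix x y z :: "'a \<times> 'b" and c d :: complex and r :: real
  show "c *\<^sub>C (x + y) = c *\<^sub>C x + c *\<^sub>C y"
    by (simp add: scaleC_prod_def scaleC_add_right)
  show "(c + d) *\<^sub>C x = c *\<^sub>C x + d *\<^sub>C x"
    by (simp add: scaleC_prod_def scaleC_add_left)
  show "c *\<^sub>C d *\<^sub>C x = (c * d) *\<^sub>C x"
    by (simp add: scaleC_prod_def scaleC_scaleC)
  show "complex_of_real r *\<^sub>C x = scaleR r x"
    by (simp add: scaleC_prod_def scaleC_of_real scaleR_prod_def)
  show "cinner x y = cnj (cinner y x)"
    by (simp add: cinner_prod_def flip: cinner_commute)
  show "cinner (x + y) z = cinner x z + cinner y z"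
    by (simp add: cinner_prod_def cinner_add_left)
  show "cinner (c *\<^sub>C x) y = c * cinner x y"
    by (simp add: cinner_prod_def scaleC_prod_def cinner_scaleC_left algebra_simps)
  show "Re (cinner x y) = inner x y"
    by (simp add: cinner_prod_def inner_prod_def Re_cinner)
qed

end

instance prod :: (chilbert, chilbert) chilbert ..

text \<open>
  An explicit basis is required because the dimension function of the library is \<open>0\<close> on
  infinite-dimensional subspaces.
\<close>

definition has_cdim :: "'a::complex_inner set \<Rightarrow> nat \<Rightarrow> bool" where
  "has_cdim S n \<longleftrightarrow>
    (\<exists>E. finite E \<and> card E = n \<and> complex_vector.independent E \<and> complex_vector.span E = S)"

definition infinite_cdim :: "'a::complex_inner itself \<Rightarrow> bool" where
  "infinite_cdim _ \<longleftrightarrow> (\<nexists>n. has_cdim (UNIV :: 'a set) n)"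

definition corthogonal :: "'a::complex_inner set \<Rightarrow> 'a set" where
  "corthogonal S = {x. \<forall>y\<in>S. cinner x y = 0}"


section \<open>Bounded operators\<close>

definition bounded_clinear :: "('a::complex_inner \<Rightarrow> 'b::complex_inner) \<Rightarrow> bool" where
  "bounded_clinear T \<longleftrightarrow> bounded_linear T \<and> (\<forall>c x. T (c *\<^sub>C x) = c *\<^sub>C T x)"

definition cadjoint :: "('a::chilbert \<Rightarrow> 'b::chilbert) \<Rightarrow> 'b \<Rightarrow> 'a" where
  "cadjoint T = (THE G. \<forall>x y. cinner (T x) y = cinner x (G y))"

definition selfadjoint :: "('a::chilbert \<Rightarrow> 'a) \<Rightarrow> bool" where
  "selfadjoint A \<longleftrightarrow> bounded_clinear A \<and> cadjoint A = A"

definition positive_op :: "('a::chilbert \<Rightarrow> 'a) \<Rightarrow> bool" where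
  "positive_op P \<longleftrightarrow>
    bounded_clinear P \<and> (\<forall>x. Im (cinner (P x) x) = 0 \<and> 0 \<le> Re (cinner (P x) x))"

definition sqrt_op :: "('a::chilbert \<Rightarrow> 'a) \<Rightarrow> 'a \<Rightarrow> 'a" where
  "sqrt_op R = (THE P. positive_op P \<and> P \<circ> P = R)"

definition abs_op :: "('a::chilbert \<Rightarrow> 'b::chilbert) \<Rightarrow> 'a \<Rightarrow> 'a" where
  "abs_op T = sqrt_op (cadjoint T \<circ> T)"


section \<open>Spectral scale, spectral spread and singular values\<close>

text \<open>
  The spectral scale is indexed by the nonzero integers; the value at index \<open>0\<close> is meaningless.
  It is used only for self-adjoint operators on infinite-dimensional spaces, where all the suprema
  and infima below are over nonempty bounded sets of reals and \<open>\<langle>A\<psi>, \<psi>\<rangle>\<close> equals its real part.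
\<close>

definition spectral_scale :: "('a::chilbert \<Rightarrow> 'a) \<Rightarrow> int \<Rightarrow> real" where
  "spectral_scale A i =
    (if i > 0 then
       (INF S\<in>{S. has_cdim S (nat (i - 1))}.
          SUP \<psi>\<in>{\<psi> \<in> corthogonal S. norm \<psi> = 1}. Re (cinner (A \<psi>) \<psi>))
     else
       (SUP S\<in>{S. has_cdim S (nat (- i - 1))}.
          INF \<psi>\<in>{\<psi> \<in> corthogonal S. norm \<psi> = 1}. Re (cinner (A \<psi>) \<psi>)))"

text \<open>
  From here on a sequence indexed by \<open>{1, 2, \<dots>}\<close> is a function on \<^typ>\<open>nat\<close> whose value at \<open>n\<close> is
  the term with index \<open>n + 1\<close>.
\<close>

definition spectral_spread :: "('a::chilbert \<Rightarrow> 'a) \<Rightarrow> nat \<Rightarrow> real" where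
  "spectral_spread A n = spectral_scale A (int (Suc n)) - spectral_scale A (- int (Suc n))"

text \<open>
  The eigenvalues of a self-adjoint operator on a finite-dimensional space, in non-increasing order,
  each repeated according to its multiplicity.
\<close>

definition eigenvalue_list :: "('a::chilbert \<Rightarrow> 'a) \<Rightarrow> real list" where
  "eigenvalue_list P =
    (THE xs. sorted_wrt (\<ge>) xs \<and>
       (\<forall>\<mu>. count_list xs \<mu> = complex_vector.dim {x. P x = complex_of_real \<mu> *\<^sub>C x}))"

definition singular_value :: "('a::chilbert \<Rightarrow> 'b::chilbert) \<Rightarrow> nat \<Rightarrow> real" where
  "singular_value T n =
    (if infinite_cdim TYPE('a) then spectral_scale (abs_op T) (int (Suc n))
     else let xs = eigenvalue_list (abs_op T) in if n < length xs then xs ! n else 0)"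


section \<open>Square-summable families\<close>

typedef 'i ell2 = "{f :: 'i \<Rightarrow> complex. (\<lambda>i. (cmod (f i))\<^sup>2) summable_on UNIV}"
  by (rule exI[of _ "\<lambda>_. 0"]) simp

setup_lifting type_definition_ell2

lemma ell2_add:
  fixes f g :: "'i \<Rightarrow> complex"
  assumes "(\<lambda>i. (cmod (f i))\<^sup>2) summable_on UNIV" "(\<lambda>i. (cmod (g i))\<^sup>2) summable_on UNIV"
  shows "(\<lambda>i. (cmod (f i + g i))\<^sup>2) summable_on UNIV"
proof (rule summable_on_comparison_test)
  show "(\<lambda>i. 2 * (cmod (f i))\<^sup>2 + 2 * (cmod (g i))\<^sup>2) summable_on UNIV"
    by (intro summable_on_add summable_on_cmult_right assms)
  fix i
  have "(cmod (f i + g i))\<^sup>2 \<le> (cmod (f i) + cmod (g i))\<^sup>2"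
    by (simp add: norm_triangle_ineq power_mono)
  also have "\<dots> \<le> 2 * (cmod (f i))\<^sup>2 + 2 * (cmod (g i))\<^sup>2"
    using zero_le_power2[of "cmod (f i) - cmod (g i)"] unfolding power2_sum power2_diff by linarith
  finally show "(cmod (f i + g i))\<^sup>2 \<le> 2 * (cmod (f i))\<^sup>2 + 2 * (cmod (g i))\<^sup>2" .
qed auto

lemma ell2_scale:
  fixes f :: "'i \<Rightarrow> complex"
  assumes "(\<lambda>i. (cmod (f i))\<^sup>2) summable_on UNIV"
  shows "(\<lambda>i. (cmod (c * f i))\<^sup>2) summable_on UNIV"
  using summable_on_cmult_right[OF assms, of "(cmod c)\<^sup>2"]
  by (simp add: norm_mult power_mult_distrib)

lemma ell2_cinner_summable:
  fixes f g :: "'i \<Rightarrow> complex"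
  assumes "(\<lambda>i. (cmod (f i))\<^sup>2) summable_on UNIV" "(\<lambda>i. (cmod (g i))\<^sup>2) summable_on UNIV"
  shows "(\<lambda>i. f i * cnj (g i)) summable_on UNIV"
proof (rule abs_summable_summable, rule abs_summable_product)
  show "(\<lambda>i. norm (f i * f i)) summable_on UNIV"
    "(\<lambda>i. norm (cnj (g i) * cnj (g i))) summable_on UNIV"
    using assms by (simp_all add: norm_mult power2_eq_square)
qed

lemma ell2_Re_infsum:
  fixes f :: "'i \<Rightarrow> complex"
  assumes "(\<lambda>i. (cmod (f i))\<^sup>2) summable_on UNIV"
  shows "Re (\<Sum>\<^sub>\<infinity>i. f i * cnj (f i)) = (\<Sum>\<^sub>\<infinity>i. (cmod (f i))\<^sup>2)"
  using ell2_cinner_summable[OF assms assms]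
  by (subst infsum_Re[symmetric]) (simp_all add: complex_norm_square[symmetric] del: of_real_power)

instantiation ell2 :: (type) complex_inner
begin

lift_definition zero_ell2 :: "'a ell2" is "\<lambda>_. 0" by simp
lift_definition plus_ell2 :: "'a ell2 \<Rightarrow> 'a ell2 \<Rightarrow> 'a ell2" is "\<lambda>f g i. f i + g i"
  by (rule ell2_add)
lift_definition uminus_ell2 :: "'a ell2 \<Rightarrow> 'a ell2" is "\<lambda>f i. - f i" by simp
lift_definition minus_ell2 :: "'a ell2 \<Rightarrow> 'a ell2 \<Rightarrow> 'a ell2" is "\<lambda>f g i. f i - g i"
  subgoal for f g using ell2_add[of f "\<lambda>i. - g i"] by simp
  done
lift_definition scaleC_ell2 :: "complex \<Rightarrow> 'a ell2 \<Rightarrow> 'a ell2" is "\<lambda>c f i. c * f i"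
  by (rule ell2_scale)
lift_definition scaleR_ell2 :: "real \<Rightarrow> 'a ell2 \<Rightarrow> 'a ell2" is "\<lambda>r f i. complex_of_real r * f i"
  by (rule ell2_scale)
lift_definition cinner_ell2 :: "'a ell2 \<Rightarrow> 'a ell2 \<Rightarrow> complex"
  is "\<lambda>f g. \<Sum>\<^sub>\<infinity>i. f i * cnj (g i)" .

definition inner_ell2 :: "'a ell2 \<Rightarrow> 'a ell2 \<Rightarrow> real" where
  "inner_ell2 x y = Re (cinner x y)"
definition norm_ell2 :: "'a ell2 \<Rightarrow> real" where
  "norm_ell2 x = sqrt (inner x x)"
definition sgn_ell2 :: "'a ell2 \<Rightarrow> 'a ell2" where
  "sgn_ell2 x = scaleR (inverse (norm x)) x"
definition dist_ell2 :: "'a ell2 \<Rightarrow> 'a ell2 \<Rightarrow> real" where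
  "dist_ell2 x y = norm (x - y)"
definition uniformity_ell2 :: "('a ell2 \<times> 'a ell2) filter" where
  "uniformity_ell2 = (INF e\<in>{0 <..}. principal {(x, y). dist x y < e})"
definition open_ell2 :: "'a ell2 set \<Rightarrow> bool" where
  "open_ell2 U \<longleftrightarrow> (\<forall>x\<in>U. eventually (\<lambda>(x', y). x' = x \<longrightarrow> y \<in> U) uniformity)"

instance
proof
  fix x y z :: "'a ell2" and c d :: complex and r s :: real
  show "x + y + z = x + (y + z)" by transfer (simp add: algebra_simps)
  show "x + y = y + x" by transfer (simp add: algebra_simps)
  show "0 + x = x" by transfer simp
  show "- x + x = 0" by transfer simp
  show "x - y = x + - y" by transfer simp
  show "scaleR r (x + y) = scaleR r x + scaleR r y" by transfer (simp add: algebra_simps)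
  show "scaleR (r + s) x = scaleR r x + scaleR s x" by transfer (simp add: algebra_simps)
  show "scaleR r (scaleR s x) = scaleR (r * s) x" by transfer (simp add: algebra_simps)
  show "scaleR 1 x = x" by transfer simp
  show "c *\<^sub>C (x + y) = c *\<^sub>C x + c *\<^sub>C y" by transfer (simp add: algebra_simps)
  show "(c + d) *\<^sub>C x = c *\<^sub>C x + d *\<^sub>C x" by transfer (simp add: algebra_simps)
  show "c *\<^sub>C d *\<^sub>C x = (c * d) *\<^sub>C x" by transfer (simp add: algebra_simps)
  show "complex_of_real r *\<^sub>C x = scaleR r x" by transfer simp
  show comm: "cinner x y = cnj (cinner y x)" for x y :: "'a ell2"
    by transfer (simp add: mult.commute flip: infsum_cnj)
  show add: "cinner (x + y) z = cinner x z + cinner y z"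
    by transfer (simp add: distrib_right infsum_add ell2_cinner_summable)
  show scale: "cinner (c *\<^sub>C x) y = c * cinner x y" for c
    by transfer (simp add: mult.assoc infsum_cmult_right')
  show "Re (cinner x y) = inner x y" by (simp add: inner_ell2_def)
  show "sgn x = scaleR (inverse (norm x)) x" by (simp add: sgn_ell2_def)
  show "dist x y = norm (x - y)" by (simp add: dist_ell2_def)
  show "uniformity = (INF e\<in>{0 <..}. principal {(x, y::'a ell2). dist x y < e})"
    by (simp add: uniformity_ell2_def)
  show "open U \<longleftrightarrow> (\<forall>x\<in>U. eventually (\<lambda>(x', y). x' = x \<longrightarrow> y \<in> U) uniformity)" for U :: "'a ell2 set"
    by (simp add: open_ell2_def)
  show "norm x = sqrt (inner x x)" by (simp add: norm_ell2_def)
  show "inner x y = inner y x" by (subst inner_ell2_def, subst comm) (simp add: inner_ell2_def)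
  show "inner (x + y) z = inner x z + inner y z" by (simp add: inner_ell2_def add)
  have "scaleR r x = complex_of_real r *\<^sub>C x" by transfer simp
  then show "inner (scaleR r x) y = r * inner x y" by (simp add: inner_ell2_def scale)
  have sq: "inner x x = (\<Sum>\<^sub>\<infinity>i. (cmod (Rep_ell2 x i))\<^sup>2)"
    unfolding inner_ell2_def cinner_ell2.rep_eq using Rep_ell2[of x] by (intro ell2_Re_infsum) simp
  show "0 \<le> inner x x" unfolding sq by (rule infsum_nonneg) simp
  show "inner x x = 0 \<longleftrightarrow> x = 0"
  proof
    assume "inner x x = 0"
    then have "(cmod (Rep_ell2 x i))\<^sup>2 = 0" for i
      using Rep_ell2[of x] unfolding sq by (intro nonneg_infsum_le_0D[of _ UNIV]) auto
    then show "x = 0" by (intro Rep_ell2_inject[THEN iffD1] ext) (simp add: zero_ell2.rep_eq)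
  next
    assume "x = 0"
    then have "Rep_ell2 x = (\<lambda>_. 0)" by (simp add: zero_ell2.rep_eq)
    then show "inner x x = 0" unfolding sq by simp
  qed
qed

end

lemma norm_ell2_square: "(norm (x :: 'i ell2))\<^sup>2 = (\<Sum>\<^sub>\<infinity>i. (cmod (Rep_ell2 x i))\<^sup>2)"
proof -
  have "inner x x = (\<Sum>\<^sub>\<infinity>i. (cmod (Rep_ell2 x i))\<^sup>2)"
    unfolding inner_ell2_def cinner_ell2.rep_eq using Rep_ell2[of x] by (intro ell2_Re_infsum) simp
  then show ?thesis by (simp add: power2_norm_eq_inner)
qed

lemma ell2_finite_sum_le:
  "finite F \<Longrightarrow> (\<Sum>i\<in>F. (cmod (Rep_ell2 x i))\<^sup>2) \<le> (norm (x :: 'i ell2))\<^sup>2"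
  unfolding norm_ell2_square using Rep_ell2[of x] by (intro finite_sum_le_infsum) auto

instance ell2 :: (type) chilbert
proof
  fix X :: "nat \<Rightarrow> 'a ell2"
  assume X: "Cauchy X"
  have "Cauchy (\<lambda>n. Rep_ell2 (X n) i)" for i
  proof (rule metric_CauchyI)
    fix e :: real assume "0 < e"
    then obtain N where N: "\<And>m n. m \<ge> N \<Longrightarrow> n \<ge> N \<Longrightarrow> dist (X m) (X n) < e"
      using X unfolding Cauchy_def by blast
    have "dist (Rep_ell2 (X m) i) (Rep_ell2 (X n) i) < e" if "m \<ge> N" "n \<ge> N" for m n
    proof -
      have "(cmod (Rep_ell2 (X m - X n) i))\<^sup>2 \<le> (norm (X m - X n))\<^sup>2"
        using ell2_finite_sum_le[of "{i}" "X m - X n"] by simp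
      then have "cmod (Rep_ell2 (X m - X n) i) \<le> norm (X m - X n)"
        by (rule power2_le_imp_le) simp
      then show ?thesis using N[OF that] by (simp add: dist_norm minus_ell2.rep_eq)
    qed
    then show "\<exists>N. \<forall>m\<ge>N. \<forall>n\<ge>N. dist (Rep_ell2 (X m) i) (Rep_ell2 (X n) i) < e" by blast
  qed
  then have "convergent (\<lambda>n. Rep_ell2 (X n) i)" for i
    by (simp add: Cauchy_convergent_iff)
  then obtain f where f: "\<And>i. (\<lambda>n. Rep_ell2 (X n) i) \<longlonglongrightarrow> f i"
    unfolding convergent_def by metis
  have bound: "(\<Sum>i\<in>F. (cmod (Rep_ell2 (X n) i - f i))\<^sup>2) \<le> e\<^sup>2"
    if N: "\<And>m n. m \<ge> N \<Longrightarrow> n \<ge> N \<Longrightarrow> dist (X m) (X n) < e" and n: "n \<ge> N" and F: "finite F"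
    for N n e F
  proof (rule tendsto_upperbound)
    show "(\<lambda>m. \<Sum>i\<in>F. (cmod (Rep_ell2 (X n) i - Rep_ell2 (X m) i))\<^sup>2)
        \<longlonglongrightarrow> (\<Sum>i\<in>F. (cmod (Rep_ell2 (X n) i - f i))\<^sup>2)"
      by (intro tendsto_intros f)
    show "\<forall>\<^sub>F m in sequentially. (\<Sum>i\<in>F. (cmod (Rep_ell2 (X n) i - Rep_ell2 (X m) i))\<^sup>2) \<le> e\<^sup>2"
    proof (rule eventually_sequentiallyI)
      fix m assume "N \<le> m"
      have "(norm (X n - X m))\<^sup>2 \<le> e\<^sup>2"
        using N[OF n \<open>N \<le> m\<close>] by (intro power_mono) (auto simp: dist_norm)
      then show "(\<Sum>i\<in>F. (cmod (Rep_ell2 (X n) i - Rep_ell2 (X m) i))\<^sup>2) \<le> e\<^sup>2"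
        using ell2_finite_sum_le[OF F, of "X n - X m"] by (simp add: minus_ell2.rep_eq)
    qed
  qed simp
  have summ: "(\<lambda>i. (cmod (Rep_ell2 (X n) i - f i))\<^sup>2) summable_on UNIV"
    if "\<And>m n. m \<ge> N \<Longrightarrow> n \<ge> N \<Longrightarrow> dist (X m) (X n) < e" and "n \<ge> N" for N n e
    by (rule nonneg_bdd_above_summable_on)
      (auto intro!: bdd_aboveI2[where M = "e\<^sup>2"] bound[OF that])
  obtain N1 where N1: "\<And>m n. m \<ge> N1 \<Longrightarrow> n \<ge> N1 \<Longrightarrow> dist (X m) (X n) < 1"
    using X unfolding Cauchy_def by (meson zero_less_one)
  have "(\<lambda>i. (cmod (Rep_ell2 (X N1) i + - (Rep_ell2 (X N1) i - f i)))\<^sup>2) summable_on UNIV"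
    using Rep_ell2[of "X N1"] summ[OF N1 order_refl]
    by (intro ell2_add) (simp_all add: norm_minus_commute)
  then have fs: "(\<lambda>i. (cmod (f i))\<^sup>2) summable_on UNIV" by simp
  define L where "L = Abs_ell2 f"
  have L: "Rep_ell2 L = f" unfolding L_def using fs by (intro Abs_ell2_inverse) simp
  have "X \<longlonglongrightarrow> L"
  proof (rule metric_LIMSEQ_I)
    fix r :: real assume "0 < r"
    then have "0 < r / 2" by simp
    then obtain N where N: "\<And>m n. m \<ge> N \<Longrightarrow> n \<ge> N \<Longrightarrow> dist (X m) (X n) < r / 2"
      using X unfolding Cauchy_def by blast
    have "dist (X n) L < r" if "n \<ge> N" for n
    proof -
      have "(norm (X n - L))\<^sup>2 \<le> (r / 2)\<^sup>2"
        unfolding norm_ell2_square minus_ell2.rep_eq L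
        by (intro infsum_le_finite_sums summ[OF N that] bound[OF N that]) auto
      then have "norm (X n - L) \<le> r / 2"
        by (rule power2_le_imp_le) (use \<open>0 < r\<close> in simp)
      then show ?thesis using \<open>0 < r\<close> by (simp add: dist_norm)
    qed
    then show "\<exists>N. \<forall>n\<ge>N. dist (X n) L < r" by blast
  qed
  then show "convergent X" by (auto simp: convergent_def)
qed


section \<open>Submajorization\<close>

text \<open>
  The index type \<open>'i\<close> plays the role of a countably infinite index set, and the families are
  meant to be bounded (otherwise the diagonal operator does not map into \<open>\<ell>\<^sup>2\<close>).
\<close>

definition diag_op :: "('i \<Rightarrow> real) \<Rightarrow> 'i ell2 \<Rightarrow> 'i ell2" where
  "diag_op a x = Abs_ell2 (\<lambda>i. complex_of_real (a i) * Rep_ell2 x i)"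

definition decreasing_rearrangement :: "('i \<Rightarrow> real) \<Rightarrow> nat \<Rightarrow> real" where
  "decreasing_rearrangement a n = spectral_scale (diag_op a) (int (Suc n))"

definition submajorized :: "('i \<Rightarrow> real) \<Rightarrow> ('j \<Rightarrow> real) \<Rightarrow> bool" (infix \<open>\<prec>\<^sub>w\<close> 50) where
  "a \<prec>\<^sub>w b \<longleftrightarrow>
    (\<forall>k. (\<Sum>n<k. decreasing_rearrangement a n) \<le> (\<Sum>n<k. decreasing_rearrangement b n))"

end

theory Submission
  imports Defs
begin

text \<open>
  If \<open>x\<^sub>1, \<dots>, x\<^sub>k\<close> and \<open>y\<^sub>1, \<dots>, y\<^sub>k\<close> are orthonormal in \<open>\<H>\<close> and \<open>\<K>\<close>, then so are the vectors
  \<open>u\<^sub>i = (x\<^sub>i, y\<^sub>i) / \<surd>2\<close> and the vectors \<open>v\<^sub>i = (x\<^sub>i, - y\<^sub>i) / \<surd>2\<close>, and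
  \<open>\<langle>A u\<^sub>i, u\<^sub>i\<rangle> - \<langle>A v\<^sub>i, v\<^sub>i\<rangle> = 2 Re \<langle>B y\<^sub>i, x\<^sub>i\<rangle>\<close>. Summing over \<open>i\<close>, the Ky Fan inequality for \<open>A\<close> and for
  \<open>-A\<close> bounds the left-hand side by the partial sums of the spectral spread. On the right-hand side,
  the \<open>x\<^sub>i\<close> and \<open>y\<^sub>i\<close> are chosen greedily as approximate maximizers of \<open>Re \<langle>B y, x\<rangle>\<close> in the orthogonal
  complement of the previous choices, which comes arbitrarily close to the sum of the first \<open>k\<close>
  singular values of \<open>B\<close>.
\<close>


section \<open>Complex inner products\<close>

text \<open>\<open>B\<close> need not be compact, so the suprema of
  \<open>Re (cinner (B y) x)\<close> need not be attained. Every choice therefore carries an error,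
  and the greedy induction must also record that the chosen vectors are almost singular vectors,
  since that is what keeps the errors from piling up uncontrollably. The space K may be
  finite-dimensional, and then the greedy choice can run out of vectors. It is made only while the
  singular values are positive; vanishing ones are absorbed by the nonnegativity of the spread.
  \<open>cadjoint\<close>, \<open>sqrt_op\<close> and \<open>eigenvalue_list\<close> are definite
  descriptions, so existence and uniqueness must be settled before anything can be said about
  singular values. Submajorization is stated through diagonal operators on \<open>ell2\<close>; it
  becomes a comparison of partial sums because both sequences are already non-increasing.\<close>

lemma cinner_zero_left [simp]: "cinner 0 y = 0"
  using cinner_scaleC_left[of 0 0 y] by simp

lemma cinner_zero_right [simp]: "cinner x 0 = 0"
  using cinner_commute[of x 0] by simp

lemma cinner_add_right: "cinner x (y + z) = cinner x y + cinner x z"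
  by (metis cinner_add_left cinner_commute complex_cnj_add)

lemma cinner_scaleC_right: "cinner x (c *\<^sub>C y) = cnj c * cinner x y"
  by (metis cinner_scaleC_left cinner_commute complex_cnj_mult)

lemma cinner_minus_left: "cinner (- x) y = - cinner x y"
  using cinner_add_left[of "- x" x y] by (simp add: eq_neg_iff_add_eq_0)

lemma cinner_minus_right: "cinner x (- y) = - cinner x y"
  using cinner_add_right[of x "- y" y] by (simp add: eq_neg_iff_add_eq_0)

lemma cinner_diff_left: "cinner (x - y) z = cinner x z - cinner y z"
  using cinner_add_left[of x "- y" z] by (simp add: cinner_minus_left)

lemma cinner_diff_right: "cinner x (y - z) = cinner x y - cinner x z"
  using cinner_add_right[of x y "- z"] by (simp add: cinner_minus_right)

lemma cinner_sum_left: "cinner (\<Sum>i\<in>I. f i) y = (\<Sum>i\<in>I. cinner (f i) y)"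
  by (induction I rule: infinite_finite_induct) (simp_all add: cinner_add_left)

lemma cinner_sum_right: "cinner x (\<Sum>i\<in>I. f i) = (\<Sum>i\<in>I. cinner x (f i))"
  by (induction I rule: infinite_finite_induct) (simp_all add: cinner_add_right)

lemma cinner_scaleR_left: "cinner (r *\<^sub>R x) y = complex_of_real r * cinner x y"
  by (simp add: cinner_scaleC_left flip: scaleC_of_real)

lemma cinner_scaleR_right: "cinner x (r *\<^sub>R y) = complex_of_real r * cinner x y"
  by (simp add: cinner_scaleC_right flip: scaleC_of_real)

lemma cinner_self: "cinner x x = complex_of_real ((norm x)\<^sup>2)"
proof -
  have "Im (cinner x x) = 0"
    using arg_cong[OF cinner_commute[of x x], of Im] by simp
  then show ?thesis
    by (simp add: complex_eq_iff Re_cinner power2_norm_eq_inner)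
qed

lemma cinner_eq_zero_commute: "cinner x y = 0 \<longleftrightarrow> cinner y x = 0"
  using cinner_commute[of x y] by simp

lemma norm_scaleC: "norm (c *\<^sub>C x) = cmod c * norm x"
proof -
  have "cinner (c *\<^sub>C x) (c *\<^sub>C x) = (c * cnj c) * cinner x x"
    by (simp add: cinner_scaleC_left cinner_scaleC_right)
  also have "\<dots> = complex_of_real ((cmod c * norm x)\<^sup>2)"
    by (simp only: cinner_self power_mult_distrib of_real_mult complex_norm_square)
  finally have "complex_of_real ((norm (c *\<^sub>C x))\<^sup>2) = complex_of_real ((cmod c * norm x)\<^sup>2)"
    by (simp only: cinner_self)
  then have "(norm (c *\<^sub>C x))\<^sup>2 = (cmod c * norm x)\<^sup>2"
    by (simp only: of_real_eq_iff)
  then show ?thesis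
    by (simp add: power2_eq_iff_nonneg)
qed

text \<open>Reduces imaginary parts to the real inner product, so that Cauchy-Schwarz and the real
  Riesz theorem carry over to \<open>cinner\<close>.\<close>

lemma Im_cinner: "Im (cinner x y) = Re (cinner ((- \<i>) *\<^sub>C x) y)"
  by (simp add: cinner_minus_left cinner_scaleC_left)

lemma cinner_eqI:
  assumes "\<And>z. cinner z x = cinner z y"
  shows "x = y"
proof -
  have "cinner (x - y) (x - y) = 0"
    by (simp add: cinner_diff_right assms)
  then show ?thesis
    by (simp add: cinner_self)
qed

lemma sgn_eq_scaleC: "sgn x = complex_of_real (inverse (norm x)) *\<^sub>C x"
  by (simp only: scaleC_of_real sgn_div_norm)

lemma cinner_sgn_left: "cinner (sgn x) y = complex_of_real (inverse (norm x)) * cinner x y"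
  by (simp add: sgn_div_norm cinner_scaleR_left)

lemma cinner_span_eq_zero:
  assumes "\<forall>e\<in>E. cinner x e = 0" and "y \<in> complex_vector.span E"
  shows "cinner x y = 0"
  using assms(2)
  by (induction rule: complex_vector.span_induct_alt)
    (auto simp: cinner_add_right cinner_scaleC_right assms(1))

lemma corthogonal_span: "corthogonal (complex_vector.span E) = {x. \<forall>e\<in>E. cinner x e = 0}"
  unfolding corthogonal_def by (auto intro: cinner_span_eq_zero complex_vector.span_base)


section \<open>Orthonormal families\<close>

text \<open>A family rather than a set: vectors of two spaces can be paired by index, and a new
  vector can be appended by \<open>fun_upd\<close>.\<close>

definition orthonormal :: "('i \<Rightarrow> 'a::complex_inner) \<Rightarrow> 'i set \<Rightarrow> bool" where
  "orthonormal u I \<longleftrightarrow> (\<forall>i\<in>I. \<forall>j\<in>I. cinner (u i) (u j) = (if i = j then 1 else 0))"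

lemma orthonormal_norm: "orthonormal u I \<Longrightarrow> i \<in> I \<Longrightarrow> norm (u i) = 1"
proof -
  assume "orthonormal u I" "i \<in> I"
  then have "complex_of_real ((norm (u i))\<^sup>2) = 1"
    unfolding cinner_self[symmetric] by (simp add: orthonormal_def)
  then have "(norm (u i))\<^sup>2 = 1"
    using of_real_eq_1_iff by blast
  then show ?thesis
    using norm_ge_zero[of "u i"] by (auto simp: power2_eq_1_iff simp del: norm_ge_zero)
qed

lemma orthonormal_subset: "orthonormal u I \<Longrightarrow> J \<subseteq> I \<Longrightarrow> orthonormal u J"
  unfolding orthonormal_def by blast

lemma orthonormal_empty [simp]: "orthonormal u {}"
  by (simp add: orthonormal_def)

lemma orthonormal_upd:
  assumes "orthonormal u I" "i \<notin> I" "norm v = 1" "\<forall>j\<in>I. cinner v (u j) = 0"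
  shows "orthonormal (u(i := v)) (insert i I)"
proof -
  have "cinner v v = 1"
    using assms(3) by (simp add: cinner_self)
  moreover have "\<forall>j\<in>I. cinner (u j) v = 0"
    using assms(4) cinner_eq_zero_commute by blast
  ultimately show ?thesis
    using assms(1,2,4) unfolding orthonormal_def by (simp add: fun_upd_def)
qed

lemma orthonormal_cinner_sum:
  assumes "orthonormal u I" "finite I" "j \<in> I"
  shows "cinner (\<Sum>i\<in>I. a i *\<^sub>C u i) (u j) = a j"
proof -
  have "cinner (\<Sum>i\<in>I. a i *\<^sub>C u i) (u j) = (\<Sum>i\<in>I. if i = j then a i else 0)"
    unfolding cinner_sum_left
    using assms by (intro sum.cong) (auto simp: orthonormal_def cinner_scaleC_left)
  then show ?thesis
    using assms by simp
qed

lemma orthonormal_inj_on: "orthonormal u I \<Longrightarrow> inj_on u I"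
  unfolding orthonormal_def inj_on_def by (metis zero_neq_one)

lemma orthonormal_independent:
  assumes "orthonormal u I" "finite I"
  shows "complex_vector.independent (u ` I)"
proof (rule complex_vector.independent_if_scalars_zero)
  fix f x
  assume 0: "(\<Sum>x\<in>u ` I. f x *\<^sub>C x) = 0" and "x \<in> u ` I"
  then obtain j where j: "j \<in> I" "x = u j" by blast
  have "(\<Sum>i\<in>I. f (u i) *\<^sub>C u i) = 0"
    using 0 orthonormal_inj_on[OF assms(1)] by (simp add: sum.reindex)
  then show "f x = 0"
    using orthonormal_cinner_sum[OF assms j(1), of "\<lambda>i. f (u i)"] j by simp
qed (use assms in auto)

lemma orthonormal_expansion:
  assumes "orthonormal u I" "finite I" "v \<in> complex_vector.span (u ` I)"
  shows "v = (\<Sum>i\<in>I. cinner v (u i) *\<^sub>C u i)"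
proof -
  obtain f where "v = (\<Sum>x\<in>u ` I. f x *\<^sub>C x)"
    using assms complex_vector.span_finite[of "u ` I"] by auto
  then have v: "v = (\<Sum>i\<in>I. f (u i) *\<^sub>C u i)"
    using orthonormal_inj_on[OF assms(1)] by (simp add: sum.reindex)
  have "cinner v (u j) = f (u j)" if "j \<in> I" for j
    unfolding v using orthonormal_cinner_sum[OF assms(1,2) that, of "\<lambda>i. f (u i)"] by simp
  then show ?thesis
    using v by simp
qed

lemma orthonormal_has_cdim:
  assumes "orthonormal u I" "finite I"
  shows "has_cdim (complex_vector.span (u ` I)) (card I)"
  unfolding has_cdim_def
  using assms orthonormal_independent card_image[OF orthonormal_inj_on[OF assms(1)]]
  by blast

section \<open>Dimension counting\<close>

lemma homogeneous_system_nontrivial_solution: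
  fixes f :: "'j \<Rightarrow> 'i \<Rightarrow> 'a::field"
  assumes "finite J" "finite I" "card J < card I"
  shows "\<exists>a. (\<exists>i\<in>I. a i \<noteq> 0) \<and> (\<forall>j\<in>J. (\<Sum>i\<in>I. a i * f j i) = 0)"
  using assms
proof (induction J arbitrary: I f rule: finite_induct)
  case empty
  then obtain i where "i \<in> I" by fastforce
  then show ?case by (intro exI[of _ "\<lambda>_. 1"]) auto
next
  case (insert j J)
  show ?case
  proof (cases "\<forall>i\<in>I. f j i = 0")
    case True
    then show ?thesis
      using insert.IH[of I f] insert.prems insert.hyps by auto
  next
    case False
    then obtain p where p: "p \<in> I" "f j p \<noteq> 0" by blast
    \<comment> \<open>Gaussian elimination: equation \<open>j\<close> is used to eliminate the
      unknown \<open>p\<close>, which costs one equation and one unknown.\<close>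
    have "card J < card (I - {p})"
      using insert.prems insert.hyps p by simp
    then obtain a where a: "\<exists>i\<in>I - {p}. a i \<noteq> 0"
      "\<forall>l\<in>J. (\<Sum>i\<in>I - {p}. a i * (f l i - f l p * f j i / f j p)) = 0"
      using insert.IH[of "I - {p}" "\<lambda>l i. f l i - f l p * f j i / f j p"] insert.prems(1) by blast
    \<comment> \<open>The value \<open>- t\<close> at \<open>p\<close> is forced by equation
      \<open>j\<close>; the remaining equations were reduced so that they then hold as well.\<close>
    define t where "t = (\<Sum>i\<in>I - {p}. a i * f j i) / f j p"
    have sum: "(\<Sum>i\<in>I. (a(p := - t)) i * f l i) = - t * f l p + (\<Sum>i\<in>I - {p}. a i * f l i)" for l
      using p insert.prems by (subst sum.remove[of _ p]) (auto intro!: sum.cong)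
    have "(\<Sum>i\<in>I. (a(p := - t)) i * f l i) = 0" if "l \<in> J" for l
    proof -
      have "0 = (\<Sum>i\<in>I - {p}. a i * f l i - f l p / f j p * (a i * f j i))"
        using a(2) that by (simp add: right_diff_distrib mult.left_commute)
      also have "\<dots> = (\<Sum>i\<in>I - {p}. a i * f l i) - t * f l p"
        unfolding sum_subtractf sum_distrib_left[symmetric] t_def by simp
      finally show ?thesis unfolding sum by simp
    qed
    moreover have "(\<Sum>i\<in>I. (a(p := - t)) i * f j i) = 0"
      unfolding sum using p by (simp add: t_def)
    ultimately show ?thesis
      using a(1) by (intro exI[of _ "a(p := - t)"]) auto
  qed
qed

text \<open>Fewer homogeneous linear conditions than dimensions. Every min-max argument below rests
  on this count; \<open>E\<close> is an arbitrary finite set, so conditions of different origin can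
  be pooled and counted by cardinality.\<close>

lemma unit_vector_in_span_orthogonal:
  assumes "complex_vector.independent B" "finite B" "finite E" "card E < card B"
  obtains v where "v \<in> complex_vector.span B" "norm v = 1" "\<forall>e\<in>E. cinner v e = 0"
proof -
  obtain a where a: "\<exists>b\<in>B. a b \<noteq> 0" "\<forall>e\<in>E. (\<Sum>b\<in>B. a b * cinner b e) = 0"
    using homogeneous_system_nontrivial_solution[OF assms(3,2,4), of "\<lambda>e b. cinner b e"] by blast
  define w where "w = (\<Sum>b\<in>B. a b *\<^sub>C b)"
  have "w \<noteq> 0"
    using a(1) assms(1,2) unfolding w_def by (auto simp: complex_vector.independent_explicit_module)
  have "w \<in> complex_vector.span B"
    unfolding w_def
    by (intro complex_vector.span_sum complex_vector.span_scale complex_vector.span_base)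
  then have "sgn w \<in> complex_vector.span B"
    unfolding sgn_eq_scaleC by (rule complex_vector.span_scale)
  moreover have "cinner w e = 0" if "e \<in> E" for e
    using a(2) that by (simp add: w_def cinner_sum_left cinner_scaleC_left)
  ultimately show ?thesis
    using \<open>w \<noteq> 0\<close> by (intro that[of "sgn w"]) (auto simp: norm_sgn cinner_sgn_left)
qed

text \<open>Gram-Schmidt: a finite family cannot span the space, and a vector outside its span
  differs from its projection.\<close>

lemma infinite_cdim_orthonormal:
  assumes "infinite_cdim TYPE('a::complex_inner)"
  shows "\<exists>u::nat \<Rightarrow> 'a. orthonormal u {..<n}"
proof (induction n)
  case (Suc n)
  then obtain u :: "nat \<Rightarrow> 'a" where u: "orthonormal u {..<n}" by blast
  have "complex_vector.span (u ` {..<n}) \<noteq> UNIV"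
    using orthonormal_has_cdim[OF u] assms unfolding infinite_cdim_def by auto
  then obtain x where x: "x \<notin> complex_vector.span (u ` {..<n})" by blast
  define w where "w = x - (\<Sum>i<n. cinner x (u i) *\<^sub>C u i)"
  have "(\<Sum>i<n. cinner x (u i) *\<^sub>C u i) \<in> complex_vector.span (u ` {..<n})"
    by (intro complex_vector.span_sum complex_vector.span_scale complex_vector.span_base) auto
  then have "w \<noteq> 0"
    using x unfolding w_def by auto
  have "cinner w (u j) = 0" if "j < n" for j
    using orthonormal_cinner_sum[OF u, of j "\<lambda>i. cinner x (u i)"] that
    by (simp add: w_def cinner_diff_left)
  then have "orthonormal (u(n := sgn w)) (insert n {..<n})"
    using \<open>w \<noteq> 0\<close> by (intro orthonormal_upd u) (auto simp: norm_sgn cinner_sgn_left)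
  then show ?case
    by (auto simp: lessThan_Suc)
qed simp

text \<open>By Steinitz exchange, an orthonormal family longer than a finite spanning set is
  impossible. Used for the direct sum and for \<open>nat ell2\<close>.\<close>

lemma infinite_cdimI:
  assumes "\<And>n. \<exists>u::nat \<Rightarrow> 'a::complex_inner. orthonormal u {..<n}"
  shows "infinite_cdim TYPE('a)"
  unfolding infinite_cdim_def
proof
  assume "\<exists>n. has_cdim (UNIV :: 'a set) n"
  then obtain E :: "'a set" where E: "finite E" "complex_vector.span E = UNIV"
    unfolding has_cdim_def by blast
  obtain u :: "nat \<Rightarrow> 'a" where u: "orthonormal u {..<Suc (card E)}"
    using assms by blast
  have "card (u ` {..<Suc (card E)}) \<le> card E"
    using complex_vector.independent_span_bound[OF E(1) orthonormal_independent[OF u]] E(2) by auto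
  then show False
    using card_image[OF orthonormal_inj_on[OF u]] by simp
qed

lemma infinite_cdim_unit_orthogonal:
  assumes "infinite_cdim TYPE('a::complex_inner)" "finite E"
  obtains v :: "'a::complex_inner" where "norm v = 1" "\<forall>e\<in>E. cinner v e = 0"
proof -
  obtain u :: "nat \<Rightarrow> 'a" where u: "orthonormal u {..<Suc (card E)}"
    using infinite_cdim_orthonormal[OF assms(1)] by blast
  show ?thesis
    by (rule unit_vector_in_span_orthogonal[OF orthonormal_independent[OF u] _ assms(2)])
      (use that card_image[OF orthonormal_inj_on[OF u]] in auto)
qed

lemma infinite_cdim_prod:
  assumes "infinite_cdim TYPE('a::complex_inner)"
  shows "infinite_cdim TYPE('a \<times> 'b::complex_inner)"
proof (rule infinite_cdimI)
  fix n
  obtain u :: "nat \<Rightarrow> 'a" where "orthonormal u {..<n}"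
    using infinite_cdim_orthonormal[OF assms] by blast
  then have "orthonormal (\<lambda>i. (u i, 0 :: 'b)) {..<n}"
    by (simp add: orthonormal_def cinner_prod_def)
  then show "\<exists>u::nat \<Rightarrow> 'a \<times> 'b. orthonormal u {..<n}" by blast
qed

lemma has_cdim_extend:
  assumes "has_cdim S n" "infinite_cdim TYPE('a::complex_inner)"
  shows "\<exists>S'. S \<subseteq> S' \<and> has_cdim (S' :: 'a set) (Suc n)"
proof -
  obtain E where E: "finite E" "card E = n" "complex_vector.independent E"
    "complex_vector.span E = S"
    using assms(1) unfolding has_cdim_def by blast
  obtain v where v: "norm v = 1" "\<forall>e\<in>E. cinner v e = 0"
    using infinite_cdim_unit_orthogonal[OF assms(2) E(1)] .
  have "v \<notin> S"
    using cinner_span_eq_zero[OF v(2), of v] v(1) unfolding E(4) by (auto simp: cinner_self)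
  then have "v \<notin> E"
    using complex_vector.span_base E(4) by blast
  have "complex_vector.independent (insert v E)"
    using \<open>v \<notin> S\<close> E(3,4) by (simp add: complex_vector.independent_insertI)
  then have "has_cdim (complex_vector.span (insert v E)) (Suc n)"
    unfolding has_cdim_def using E \<open>v \<notin> E\<close>
    by (intro exI[of _ "insert v E"]) auto
  moreover have "S \<subseteq> complex_vector.span (insert v E)"
    unfolding E(4)[symmetric] by (intro complex_vector.span_mono) auto
  ultimately show ?thesis by blast
qed

text \<open>Replaces a subspace of dimension \<open>n\<close> by \<open>n\<close> linear equations
  for its complement, the form in which dimensions are counted.\<close>

lemma has_cdim_corthogonalE:
  assumes "has_cdim S n"
  obtains E where "finite E" "card E = n" "corthogonal S = {x. \<forall>e\<in>E. cinner x e = 0}"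
  using assms that unfolding has_cdim_def by (auto simp: corthogonal_span)

lemma has_cdim_exists:
  assumes "infinite_cdim TYPE('a::complex_inner)"
  shows "\<exists>S :: 'a set. has_cdim S n"
proof -
  obtain u :: "nat \<Rightarrow> 'a" where "orthonormal u {..<n}"
    using infinite_cdim_orthonormal[OF assms] by blast
  then show ?thesis
    using orthonormal_has_cdim[of u "{..<n}"] by auto
qed


section \<open>Spectral scales\<close>

lemma bounded_clinear_add: "bounded_clinear T \<Longrightarrow> T (x + y) = T x + T y"
  by (simp add: bounded_clinear_def linear_add bounded_linear.linear)

lemma bounded_clinear_diff: "bounded_clinear T \<Longrightarrow> T (x - y) = T x - T y"
  by (simp add: bounded_clinear_def linear_diff bounded_linear.linear)

lemma bounded_clinear_minus: "bounded_clinear T \<Longrightarrow> T (- x) = - T x"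
  by (simp add: bounded_clinear_def linear_neg bounded_linear.linear)

lemma bounded_clinear_zero: "bounded_clinear T \<Longrightarrow> T 0 = 0"
  by (simp add: bounded_clinear_def linear_0 bounded_linear.linear)

lemma bounded_clinear_scaleC: "bounded_clinear T \<Longrightarrow> T (c *\<^sub>C x) = c *\<^sub>C T x"
  by (simp add: bounded_clinear_def)

lemma bounded_clinear_scaleR: "bounded_clinear T \<Longrightarrow> T (r *\<^sub>R x) = r *\<^sub>R T x"
  by (simp add: bounded_clinear_def linear_scale bounded_linear.linear)

lemma bounded_clinear_sum: "bounded_clinear T \<Longrightarrow> T (\<Sum>i\<in>I. f i) = (\<Sum>i\<in>I. T (f i))"
  by (simp add: bounded_clinear_def linear_sum bounded_linear.linear)

lemma bounded_clinear_bound: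
  assumes "bounded_clinear T"
  obtains M where "M > 0" "\<And>x. norm (T x) \<le> norm x * M"
  using assms bounded_linear.pos_bounded unfolding bounded_clinear_def by blast

lemma bounded_clinear_uminus: "bounded_clinear T \<Longrightarrow> bounded_clinear (\<lambda>x. - T x)"
  by (auto simp: bounded_clinear_def intro: bounded_linear_minus)

text \<open>The minimum needed for the suprema and infima in \<open>spectral_scale\<close> to be
  over bounded sets. It can be checked for a diagonal operator directly from its quadratic
  form.\<close>

definition bounded_form :: "('a::complex_inner \<Rightarrow> 'a) \<Rightarrow> bool" where
  "bounded_form A \<longleftrightarrow> (\<exists>M. \<forall>x. norm x = 1 \<longrightarrow> \<bar>Re (cinner (A x) x)\<bar> \<le> M)"

lemma bounded_clinear_bounded_form:
  assumes "bounded_clinear A"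
  shows "bounded_form A"
proof -
  obtain M where M: "\<And>x. norm (A x) \<le> norm x * M"
    using bounded_clinear_bound[OF assms] by blast
  have "\<bar>Re (cinner (A x) x)\<bar> \<le> M" if "norm x = 1" for x
    using Cauchy_Schwarz_ineq2[of "A x" x] M[of x] that by (simp add: Re_cinner)
  then show ?thesis
    unfolding bounded_form_def by blast
qed

lemma spectral_scale_Suc:
  "spectral_scale A (int (Suc n)) =
    (INF S\<in>{S. has_cdim S n}. SUP \<psi>\<in>{\<psi> \<in> corthogonal S. norm \<psi> = 1}. Re (cinner (A \<psi>) \<psi>))"
  by (simp add: spectral_scale_def)

text \<open>A real infimum is minus the supremum of the negatives, so lower indices of
  \<open>A\<close> become upper indices of \<open>-A\<close>. All estimates can then be made for
  positive indices.\<close>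

lemma spectral_scale_minus:
  "spectral_scale A (- int (Suc n)) = - spectral_scale (\<lambda>x. - A x) (int (Suc n))"
proof -
  have inf: "(INF \<psi>\<in>X. f \<psi>) = - (SUP \<psi>\<in>X. - f \<psi>)" for f :: "'a \<Rightarrow> real" and X
    by (simp add: Inf_real_def image_image)
  have sup: "(SUP S\<in>Y. - g S) = - (INF S\<in>Y. g S)" for g :: "'a set \<Rightarrow> real" and Y
    by (simp add: Inf_real_def image_image)
  have "spectral_scale A (- int (Suc n)) = (SUP S\<in>{S. has_cdim S n}.
          INF \<psi>\<in>{\<psi> \<in> corthogonal S. norm \<psi> = 1}. Re (cinner (A \<psi>) \<psi>))"
    by (simp add: spectral_scale_def)
  then show ?thesis
    unfolding spectral_scale_Suc inf sup by (simp add: cinner_minus_left)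
qed

lemma SUP_form_upper:
  assumes "bounded_form A" "\<psi> \<in> corthogonal S" "norm \<psi> = 1"
  shows "Re (cinner (A \<psi>) \<psi>) \<le> (SUP \<psi>\<in>{\<psi> \<in> corthogonal S. norm \<psi> = 1}. Re (cinner (A \<psi>) \<psi>))"
proof -
  obtain M where M: "\<And>x. norm x = 1 \<Longrightarrow> \<bar>Re (cinner (A x) x)\<bar> \<le> M"
    using assms(1) unfolding bounded_form_def by blast
  show ?thesis
    using assms(2,3) by (intro cSUP_upper) (auto intro!: bdd_aboveI2[of _ _ M] dest!: M)
qed

lemma unit_vector_corthogonal:
  assumes "infinite_cdim TYPE('a::complex_inner)" "has_cdim (S :: 'a set) n"
  obtains \<psi> where "\<psi> \<in> corthogonal S" "norm \<psi> = 1"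
proof -
  obtain E where E: "finite E" "card E = n" "corthogonal S = {x. \<forall>e\<in>E. cinner x e = 0}"
    by (rule has_cdim_corthogonalE[OF assms(2)])
  obtain v :: 'a where "norm v = 1" "\<forall>e\<in>E. cinner v e = 0"
    by (rule infinite_cdim_unit_orthogonal[OF assms(1) E(1)])
  then show ?thesis
    by (intro that[of v]) (auto simp: E(3))
qed

text \<open>Each complement contains a unit vector because the space is infinite-dimensional, so no
  supremum drops below \<open>- M\<close>.\<close>

lemma bdd_below_SUP_form:
  assumes "infinite_cdim TYPE('a::chilbert)" "bounded_form (A :: 'a \<Rightarrow> 'a)"
  shows "bdd_below ((\<lambda>S. SUP \<psi>\<in>{\<psi> \<in> corthogonal S. norm \<psi> = 1}. Re (cinner (A \<psi>) \<psi>))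
    ` {S. has_cdim S n})"
proof -
  obtain M where M: "\<And>x. norm x = 1 \<Longrightarrow> \<bar>Re (cinner (A x) x)\<bar> \<le> M"
    using assms(2) unfolding bounded_form_def by blast
  have "- M \<le> (SUP \<psi>\<in>{\<psi> \<in> corthogonal S. norm \<psi> = 1}. Re (cinner (A \<psi>) \<psi>))"
    if S: "has_cdim S n" for S
  proof -
    obtain \<psi> where \<psi>: "\<psi> \<in> corthogonal S" "norm \<psi> = 1"
      using unit_vector_corthogonal[OF assms(1) S] .
    show ?thesis
      using SUP_form_upper[OF assms(2) \<psi>] M[OF \<psi>(2)] by linarith
  qed
  then show ?thesis
    by (intro bdd_belowI2[of _ "- M"]) auto
qed

text \<open>For an upper bound one subspace suffices; for a lower bound every complement needs a
  test vector. This lemma and the next three hide \<open>INF\<close> and \<open>SUP\<close> from the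
  later arguments.\<close>

lemma spectral_scale_le:
  assumes "infinite_cdim TYPE('a::chilbert)" "bounded_form (A :: 'a \<Rightarrow> 'a)" "has_cdim S n"
    and "\<And>\<psi>. \<psi> \<in> corthogonal S \<Longrightarrow> norm \<psi> = 1 \<Longrightarrow> Re (cinner (A \<psi>) \<psi>) \<le> c"
  shows "spectral_scale A (int (Suc n)) \<le> c"
  unfolding spectral_scale_Suc
proof (rule order_trans)
  show "(INF S\<in>{S. has_cdim S n}. SUP \<psi>\<in>{\<psi> \<in> corthogonal S. norm \<psi> = 1}. Re (cinner (A \<psi>) \<psi>))
      \<le> (SUP \<psi>\<in>{\<psi> \<in> corthogonal S. norm \<psi> = 1}. Re (cinner (A \<psi>) \<psi>))"
    using assms(3) by (intro cINF_lower bdd_below_SUP_form[OF assms(1,2)]) auto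
  show "(SUP \<psi>\<in>{\<psi> \<in> corthogonal S. norm \<psi> = 1}. Re (cinner (A \<psi>) \<psi>)) \<le> c"
    using unit_vector_corthogonal[OF assms(1,3)] assms(4) by (intro cSUP_least) auto
qed

lemma spectral_scale_ge:
  assumes "infinite_cdim TYPE('a::chilbert)" "bounded_form (A :: 'a \<Rightarrow> 'a)"
    and "\<And>S. has_cdim S n \<Longrightarrow> \<exists>\<psi>\<in>corthogonal S. norm \<psi> = 1 \<and> c \<le> Re (cinner (A \<psi>) \<psi>)"
  shows "c \<le> spectral_scale A (int (Suc n))"
  unfolding spectral_scale_Suc
proof (rule cINF_greatest)
  show "{S :: 'a set. has_cdim S n} \<noteq> {}"
    using has_cdim_exists[OF assms(1)] by blast
  fix S :: "'a set" assume "S \<in> {S. has_cdim S n}"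
  then obtain \<psi> where "\<psi> \<in> corthogonal S" "norm \<psi> = 1" "c \<le> Re (cinner (A \<psi>) \<psi>)"
    using assms(3) by blast
  then show "c \<le> (SUP \<psi>\<in>{\<psi> \<in> corthogonal S. norm \<psi> = 1}. Re (cinner (A \<psi>) \<psi>))"
    using SUP_form_upper[OF assms(2)] by force
qed

lemma spectral_scale_lessD:
  assumes "infinite_cdim TYPE('a::chilbert)" "bounded_form (A :: 'a \<Rightarrow> 'a)"
    and "spectral_scale A (int (Suc n)) < c"
  obtains S where "has_cdim S n"
    "\<And>\<psi>. \<psi> \<in> corthogonal S \<Longrightarrow> norm \<psi> = 1 \<Longrightarrow> Re (cinner (A \<psi>) \<psi>) < c"
proof -
  have ne: "{S :: 'a set. has_cdim S n} \<noteq> {}"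
    using has_cdim_exists[OF assms(1)] by blast
  obtain S where S: "has_cdim S n"
    "(SUP \<psi>\<in>{\<psi> \<in> corthogonal S. norm \<psi> = 1}. Re (cinner (A \<psi>) \<psi>)) < c"
    using assms(3) unfolding spectral_scale_Suc
      cINF_less_iff[OF ne bdd_below_SUP_form[OF assms(1,2)]] by blast
  show ?thesis
    using SUP_form_upper[OF assms(2)] S(2) by (intro that[OF S(1)]) force
qed

lemma less_spectral_scaleD:
  assumes "infinite_cdim TYPE('a::chilbert)" "bounded_form (A :: 'a \<Rightarrow> 'a)"
    and "c < spectral_scale A (int (Suc n))" and "has_cdim S n"
  obtains \<psi> where "\<psi> \<in> corthogonal S" "norm \<psi> = 1" "c < Re (cinner (A \<psi>) \<psi>)"
proof (rule ccontr)
  assume "\<not> thesis"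
  then have "Re (cinner (A \<psi>) \<psi>) \<le> c" if "\<psi> \<in> corthogonal S" "norm \<psi> = 1" for \<psi>
    using that \<open>\<And>\<psi>. \<psi> \<in> corthogonal S \<Longrightarrow> norm \<psi> = 1 \<Longrightarrow> c < Re (cinner (A \<psi>) \<psi>) \<Longrightarrow> thesis\<close>
    by force
  then show False
    using spectral_scale_le[OF assms(1,2,4)] assms(3) by force
qed

lemma spectral_scale_Suc_le:
  assumes "infinite_cdim TYPE('a::chilbert)" "bounded_form (A :: 'a \<Rightarrow> 'a)"
  shows "spectral_scale A (int (Suc (Suc n))) \<le> spectral_scale A (int (Suc n))"
proof (rule dense_ge)
  fix c assume "spectral_scale A (int (Suc n)) < c"
  then obtain S where S: "has_cdim S n"
    "\<And>\<psi>. \<psi> \<in> corthogonal S \<Longrightarrow> norm \<psi> = 1 \<Longrightarrow> Re (cinner (A \<psi>) \<psi>) < c"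
    using spectral_scale_lessD[OF assms] by blast
  obtain S' where S': "S \<subseteq> S'" "has_cdim S' (Suc n)"
    using has_cdim_extend[OF S(1) assms(1)] by blast
  have "corthogonal S' \<subseteq> corthogonal S"
    using S'(1) by (auto simp: corthogonal_def)
  then show "spectral_scale A (int (Suc (Suc n))) \<le> c"
    using S(2) by (intro spectral_scale_le[OF assms S'(2)] less_imp_le) auto
qed

lemma bounded_form_uminus: "bounded_form A \<Longrightarrow> bounded_form (\<lambda>x. - A x)"
  by (simp add: bounded_form_def cinner_minus_left)

lemma spectral_spread_eq:
  "spectral_spread A n =
    spectral_scale A (int (Suc n)) + spectral_scale (\<lambda>x. - A x) (int (Suc n))"
  by (simp only: spectral_spread_def spectral_scale_minus)

lemma antimono_spectral_spread:
  assumes "infinite_cdim TYPE('a::chilbert)" "bounded_form (A :: 'a \<Rightarrow> 'a)"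
  shows "antimono (spectral_spread A)"
  unfolding decseq_Suc_iff spectral_spread_eq
  by (intro allI add_mono spectral_scale_Suc_le bounded_form_uminus assms)

text \<open>A single unit vector can be orthogonal to nearly optimal subspaces for \<open>A\<close>
  and for \<open>-A\<close> simultaneously. The two forms cancel at it, so the sum of the two bounds
  is positive.\<close>

lemma spectral_spread_nonneg:
  assumes "infinite_cdim TYPE('a::chilbert)" "bounded_form (A :: 'a \<Rightarrow> 'a)"
  shows "0 \<le> spectral_spread A n"
proof (rule field_le_epsilon)
  fix e :: real assume "0 < e"
  then have "spectral_scale A (int (Suc n)) < spectral_scale A (int (Suc n)) + e / 2"
    "spectral_scale (\<lambda>x. - A x) (int (Suc n)) < spectral_scale (\<lambda>x. - A x) (int (Suc n)) + e / 2"
    by simp_all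
  note less = this
  obtain S where S: "has_cdim S n" "\<And>\<psi>. \<psi> \<in> corthogonal S \<Longrightarrow> norm \<psi> = 1 \<Longrightarrow>
      Re (cinner (A \<psi>) \<psi>) < spectral_scale A (int (Suc n)) + e / 2"
    using spectral_scale_lessD[OF assms less(1)] by blast
  obtain S' where S': "has_cdim S' n" "\<And>\<psi>. \<psi> \<in> corthogonal S' \<Longrightarrow> norm \<psi> = 1 \<Longrightarrow>
      Re (cinner (- A \<psi>) \<psi>) < spectral_scale (\<lambda>x. - A x) (int (Suc n)) + e / 2"
    using spectral_scale_lessD[OF assms(1) bounded_form_uminus[OF assms(2)] less(2)] by blast
  obtain E where E: "finite E" "card E = n" "corthogonal S = {x. \<forall>e\<in>E. cinner x e = 0}"
    by (rule has_cdim_corthogonalE[OF S(1)])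
  obtain E' where E': "finite E'" "card E' = n" "corthogonal S' = {x. \<forall>e\<in>E'. cinner x e = 0}"
    by (rule has_cdim_corthogonalE[OF S'(1)])
  have "finite (E \<union> E')"
    using E(1) E'(1) by simp
  obtain \<psi> :: 'a where "norm \<psi> = 1" "\<forall>e\<in>E \<union> E'. cinner \<psi> e = 0"
    by (rule infinite_cdim_unit_orthogonal[OF assms(1) \<open>finite (E \<union> E')\<close>])
  then show "0 \<le> spectral_spread A n + e"
    using S(2)[of \<psi>] S'(2)[of \<psi>] E(3) E'(3) unfolding spectral_spread_eq by (simp add: cinner_minus_left)
qed


section \<open>The Ky Fan inequality\<close>

text \<open>The vectors are chosen from the last index downwards. At index \<open>i\<close> there
  are at most \<open>i\<close> conditions from \<open>E i\<close> and \<open>k - 1 - i\<close> from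
  the vectors already chosen, hence at most \<open>k - 1\<close> in a space of dimension
  \<open>k\<close>. Going upwards, up to \<open>2 * i\<close> conditions would meet at index
  \<open>i\<close>.\<close>

lemma adapted_orthonormal:
  assumes u: "orthonormal (u :: nat \<Rightarrow> 'a::complex_inner) {..<k}"
    and E: "\<And>i. i < k \<Longrightarrow> finite (E i)" "\<And>i. i < k \<Longrightarrow> card (E i) \<le> i"
  shows "\<exists>w. orthonormal w {..<k} \<and>
    (\<forall>i<k. w i \<in> complex_vector.span (u ` {..<k}) \<and> (\<forall>e\<in>E i. cinner (w i) e = 0))"
proof -
  \<comment> \<open>\<open>m\<close> is the number of vectors already chosen; they occupy the last
    \<open>m\<close> indices.\<close>
  have "\<exists>w. orthonormal w {k - m..<k} \<and> (\<forall>i\<in>{k - m..<k}.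
      w i \<in> complex_vector.span (u ` {..<k}) \<and> (\<forall>e\<in>E i. cinner (w i) e = 0))" if "m \<le> k" for m
    using that
  proof (induction m)
    case (Suc m)
    then obtain w where w: "orthonormal w {k - m..<k}" "\<forall>i\<in>{k - m..<k}.
      w i \<in> complex_vector.span (u ` {..<k}) \<and> (\<forall>e\<in>E i. cinner (w i) e = 0)"
      by auto
    let ?i = "k - Suc m"
    have eq: "{?i..<k} = insert ?i {k - m..<k}"
      using Suc.prems by auto
    have "card (E ?i \<union> w ` {k - m..<k}) \<le> ?i + m"
      using E[of ?i] Suc.prems card_image_le[of "{k - m..<k}" w]
      by (intro card_Un_le[THEN order_trans] add_mono) auto
    also have "\<dots> < card (u ` {..<k})"
      using Suc.prems card_image[OF orthonormal_inj_on[OF u]] by simp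
    finally have card: "card (E ?i \<union> w ` {k - m..<k}) < card (u ` {..<k})" .
    have fin: "finite (E ?i \<union> w ` {k - m..<k})"
      using E(1)[of ?i] Suc.prems by simp
    obtain v where v: "v \<in> complex_vector.span (u ` {..<k})" "norm v = 1"
      "\<forall>e\<in>E ?i \<union> w ` {k - m..<k}. cinner v e = 0"
      by (rule unit_vector_in_span_orthogonal[OF orthonormal_independent[OF u] _ fin card]) auto
    have orth: "orthonormal (w(?i := v)) (insert ?i {k - m..<k})"
      using Suc.prems v by (intro orthonormal_upd w(1)) auto
    show ?case
      unfolding eq using v w(2) by (intro exI[of _ "w(?i := v)"] conjI orth) auto
  qed auto
  from this[of k] show ?thesis
    by (simp add: atLeast0LessThan Ball_def)
qed

text \<open>The trace of the compression of \<open>A\<close> to a finite-dimensional subspace does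
  not depend on the orthonormal basis: both sums equal one double sum.\<close>

lemma orthonormal_trace_eq:
  assumes A: "bounded_clinear A" and u: "orthonormal u I" and w: "orthonormal w I"
    and fin: "finite I" and sub: "\<And>i. i \<in> I \<Longrightarrow> w i \<in> complex_vector.span (u ` I)"
  shows "(\<Sum>i\<in>I. cinner (A (u i)) (u i)) = (\<Sum>i\<in>I. cinner (A (w i)) (w i))"
proof -
  have card: "card (u ` I) = card (w ` I)"
    by (simp add: card_image orthonormal_inj_on[OF u] orthonormal_inj_on[OF w])
  have wI: "w ` I \<subseteq> complex_vector.span (u ` I)"
    using sub by blast
  \<comment> \<open>Otherwise \<open>u i\<close> and the family \<open>w\<close> would be too many
    independent vectors in the span of \<open>u\<close>.\<close>
  have "u i \<in> complex_vector.span (w ` I)" if "i \<in> I" for i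
  proof (rule ccontr)
    assume neg: "u i \<notin> complex_vector.span (w ` I)"
    then have "complex_vector.independent (insert (u i) (w ` I))"
      by (rule complex_vector.independent_insertI[OF _ orthonormal_independent[OF w fin]])
    moreover have "insert (u i) (w ` I) \<subseteq> complex_vector.span (u ` I)"
      using wI that by (simp add: complex_vector.span_base)
    ultimately have "card (insert (u i) (w ` I)) \<le> card (u ` I)"
      by (intro conjunct2[OF complex_vector.independent_span_bound[OF finite_imageI[OF fin]]])
    moreover have "u i \<notin> w ` I"
      using neg complex_vector.span_base[of "u i" "w ` I"] by argo
    ultimately show False
      using card fin by simp
  qed
  note uw = this
  have ue: "u i = (\<Sum>j\<in>I. cinner (u i) (w j) *\<^sub>C w j)" if "i \<in> I" for i
    by (rule orthonormal_expansion[OF w fin uw[OF that]])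
  have we: "w j = (\<Sum>i\<in>I. cinner (w j) (u i) *\<^sub>C u i)" if "j \<in> I" for j
    by (rule orthonormal_expansion[OF u fin sub[OF that]])
  have "(\<Sum>i\<in>I. cinner (A (u i)) (u i)) = (\<Sum>i\<in>I. \<Sum>j\<in>I. cinner (w j) (u i) * cinner (A (u i)) (w j))"
  proof (rule sum.cong)
    fix i assume i: "i \<in> I"
    have "cinner (A (u i)) (u i) = cinner (A (u i)) (\<Sum>j\<in>I. cinner (u i) (w j) *\<^sub>C w j)"
      by (rule arg_cong[OF ue[OF i]])
    then show "cinner (A (u i)) (u i) = (\<Sum>j\<in>I. cinner (w j) (u i) * cinner (A (u i)) (w j))"
      by (simp add: cinner_sum_right cinner_scaleC_right flip: cinner_commute)
  qed simp
  also have "\<dots> = (\<Sum>j\<in>I. \<Sum>i\<in>I. cinner (w j) (u i) * cinner (A (u i)) (w j))"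
    by (rule sum.swap)
  also have "\<dots> = (\<Sum>j\<in>I. cinner (A (w j)) (w j))"
  proof (rule sum.cong)
    fix j assume j: "j \<in> I"
    have "cinner (A (w j)) (w j) = cinner (A (\<Sum>i\<in>I. cinner (w j) (u i) *\<^sub>C u i)) (w j)"
      by (rule arg_cong[OF we[OF j], of "\<lambda>x. cinner (A x) (w j)"])
    then show "(\<Sum>i\<in>I. cinner (w j) (u i) * cinner (A (u i)) (w j)) = cinner (A (w j)) (w j)"
      by (simp add: bounded_clinear_sum[OF A] bounded_clinear_scaleC[OF A] cinner_sum_left
          cinner_scaleC_left)
  qed simp
  finally show ?thesis .
qed

text \<open>Each vector of an orthonormal basis adapted to nearly optimal subspaces \<open>S i\<close> is orthogonal to
  its own \<open>S i\<close>, so the trace over that basis is bounded term by term.\<close>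

lemma Ky_Fan_le:
  assumes inf: "infinite_cdim TYPE('a::chilbert)" and A: "bounded_clinear (A :: 'a \<Rightarrow> 'a)"
    and u: "orthonormal u {..<k}"
  shows "(\<Sum>i<k. Re (cinner (A (u i)) (u i))) \<le> (\<Sum>i<k. spectral_scale A (int (Suc i)))"
proof (rule field_le_epsilon)
  fix e :: real assume "0 < e"
  \<comment> \<open>The slack \<open>e\<close> is shared among the \<open>k\<close> indices;
    \<open>Suc k\<close> keeps the quotient meaningful for \<open>k = 0\<close>.\<close>
  define d where "d = e / real (Suc k)"
  have d: "0 < d" "real k * d \<le> e"
    using \<open>0 < e\<close> by (auto simp: d_def field_simps)
  have "\<exists>E. finite E \<and> card E = i \<and> (\<forall>\<psi>. (\<forall>e\<in>E. cinner \<psi> e = 0) \<longrightarrow> norm \<psi> = 1 \<longrightarrow>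
      Re (cinner (A \<psi>) \<psi>) < spectral_scale A (int (Suc i)) + d)" for i
  proof -
    have "spectral_scale A (int (Suc i)) < spectral_scale A (int (Suc i)) + d"
      using d(1) by simp
    then obtain S where S: "has_cdim S i" "\<And>\<psi>. \<psi> \<in> corthogonal S \<Longrightarrow> norm \<psi> = 1 \<Longrightarrow>
        Re (cinner (A \<psi>) \<psi>) < spectral_scale A (int (Suc i)) + d"
      by (rule spectral_scale_lessD[OF inf bounded_clinear_bounded_form[OF A]]) blast
    obtain E where E: "finite E" "card E = i" "corthogonal S = {x. \<forall>e\<in>E. cinner x e = 0}"
      by (rule has_cdim_corthogonalE[OF S(1)])
    then show ?thesis
      using S(2) unfolding E(3) by (intro exI[of _ E]) auto
  qed
  then obtain E where E: "\<And>i. finite (E i)" "\<And>i. card (E i) = i"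
    "\<And>i \<psi>. \<forall>e\<in>E i. cinner \<psi> e = 0 \<Longrightarrow> norm \<psi> = 1 \<Longrightarrow>
      Re (cinner (A \<psi>) \<psi>) < spectral_scale A (int (Suc i)) + d"
    by metis
  obtain w where w: "orthonormal w {..<k}" "\<And>i. i < k \<Longrightarrow> w i \<in> complex_vector.span (u ` {..<k})"
    "\<And>i. i < k \<Longrightarrow> \<forall>e\<in>E i. cinner (w i) e = 0"
    using adapted_orthonormal[OF u, of E] E(1,2) by auto
  have "(\<Sum>i<k. Re (cinner (A (u i)) (u i))) = (\<Sum>i<k. Re (cinner (A (w i)) (w i)))"
    using orthonormal_trace_eq[OF A u w(1)] w(2) by (simp flip: Re_sum)
  also have "\<dots> \<le> (\<Sum>i<k. spectral_scale A (int (Suc i)) + d)"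
    using w(3) orthonormal_norm[OF w(1)] by (intro sum_mono less_imp_le E(3)) auto
  also have "\<dots> \<le> (\<Sum>i<k. spectral_scale A (int (Suc i))) + e"
    using d(2) by (simp add: sum.distrib)
  finally show "(\<Sum>i<k. Re (cinner (A (u i)) (u i))) \<le> (\<Sum>i<k. spectral_scale A (int (Suc i))) + e" .
qed


section \<open>Rearrangement of monotone sequences\<close>

text \<open>\<open>Abs_ell2\<close> returns the intended coordinates only for square-summable
  arguments, which the bound on \<open>a\<close> guarantees.\<close>

lemma Rep_diag_op:
  assumes "\<And>i. \<bar>a i\<bar> \<le> M"
  shows "Rep_ell2 (diag_op a x) i = complex_of_real (a i) * Rep_ell2 x i"
proof -
  have "(\<lambda>i. (cmod (complex_of_real (a i) * Rep_ell2 x i))\<^sup>2) summable_on UNIV"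
  proof (rule summable_on_comparison_test)
    show "(\<lambda>i. M\<^sup>2 * (cmod (Rep_ell2 x i))\<^sup>2) summable_on UNIV"
      using Rep_ell2[of x] by (intro summable_on_cmult_right) simp
    show "(cmod (complex_of_real (a i) * Rep_ell2 x i))\<^sup>2 \<le> M\<^sup>2 * (cmod (Rep_ell2 x i))\<^sup>2" for i
      using power_mono[OF assms[of i] abs_ge_zero, of 2]
      by (auto simp: norm_mult power_mult_distrib intro: mult_right_mono)
  qed auto
  then show ?thesis
    by (simp add: diag_op_def Abs_ell2_inverse)
qed

text \<open>The form is the sum of \<open>a i\<close> weighted by the squared moduli of the
  coordinates, so only the support of \<open>x\<close> matters. Taking one side constant yields
  bounds by a single term of the sequence.\<close>

lemma diag_op_form_le:
  fixes a b :: "'i \<Rightarrow> real"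
  assumes "\<And>i. \<bar>a i\<bar> \<le> M" "\<And>i. \<bar>b i\<bar> \<le> N" and "\<And>i. Rep_ell2 x i \<noteq> 0 \<Longrightarrow> a i \<le> b i"
  shows "Re (cinner (diag_op a x) x) \<le> Re (cinner (diag_op b x) x)"
proof -
  have summable: "(\<lambda>i. Rep_ell2 (diag_op c x) i * cnj (Rep_ell2 x i)) summable_on UNIV"
    for c :: "'i \<Rightarrow> real"
    using Rep_ell2[of "diag_op c x"] Rep_ell2[of x] by (intro ell2_cinner_summable) auto
  have form: "Re (cinner (diag_op c x) x) = (\<Sum>\<^sub>\<infinity>i. Re (Rep_ell2 (diag_op c x) i * cnj (Rep_ell2 x i)))"
    for c :: "'i \<Rightarrow> real"
    unfolding cinner_ell2.rep_eq by (rule infsum_Re[symmetric, OF summable])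
  have "Re (Rep_ell2 (diag_op c x) i * cnj (Rep_ell2 x i)) = c i * (cmod (Rep_ell2 x i))\<^sup>2"
    if "\<And>i. \<bar>c i\<bar> \<le> K" for c :: "'i \<Rightarrow> real" and K i
    unfolding Rep_diag_op[of c, OF that] mult.assoc complex_norm_square[symmetric] by simp
  note coord = this[OF assms(1)] this[OF assms(2)]
  show ?thesis
    unfolding form
  proof (rule infsum_mono)
    show "Re (Rep_ell2 (diag_op a x) i * cnj (Rep_ell2 x i))
        \<le> Re (Rep_ell2 (diag_op b x) i * cnj (Rep_ell2 x i))" for i
      unfolding coord using assms(3)[of i]
      by (cases "Rep_ell2 x i = 0") (auto intro: mult_right_mono)
  qed (rule summable_on_Re[OF summable])+
qed

lemma diag_op_const: "diag_op (\<lambda>_. c) x = c *\<^sub>R x"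
  by (intro Rep_ell2_inject[THEN iffD1] ext)
    (simp add: Rep_diag_op[of "\<lambda>_. c" "\<bar>c\<bar>"] scaleR_ell2.rep_eq)

lemma diag_op_const_form: "norm x = 1 \<Longrightarrow> Re (cinner (diag_op (\<lambda>_. c) x) x) = c"
  by (simp add: diag_op_const cinner_scaleR_left cinner_self)

definition ell2_unit :: "'i \<Rightarrow> 'i ell2" where
  "ell2_unit i = Abs_ell2 (\<lambda>j. if j = i then 1 else 0)"

lemma Rep_ell2_unit: "Rep_ell2 (ell2_unit i) j = (if j = i then 1 else 0)"
proof -
  have "(\<lambda>j. (cmod (if j = i then 1 else 0))\<^sup>2) summable_on UNIV"
    using summable_on_cong_neutral[of "{i}" UNIV "\<lambda>j. (cmod (if j = i then 1 else 0))\<^sup>2"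
        "\<lambda>j. (cmod (if j = i then 1 else 0))\<^sup>2"] by auto
  then show ?thesis
    by (simp add: ell2_unit_def Abs_ell2_inverse)
qed

lemma cinner_ell2_unit: "cinner x (ell2_unit i) = Rep_ell2 x i"
  unfolding cinner_ell2.rep_eq
  using infsum_cong_neutral[of "{i}" UNIV "\<lambda>j. Rep_ell2 x j * cnj (Rep_ell2 (ell2_unit i) j)"
      "\<lambda>j. Rep_ell2 x j * cnj (Rep_ell2 (ell2_unit i) j)"]
  by (simp add: Rep_ell2_unit)

lemma orthonormal_ell2_unit: "orthonormal ell2_unit I"
  by (auto simp: orthonormal_def cinner_ell2_unit Rep_ell2_unit)

text \<open>Upper bound: removing the first \<open>n\<close> unit vectors leaves vectors supported
  where \<open>a\<close> is at most \<open>a n\<close>. Lower bound: \<open>n\<close> conditions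
  cannot exclude all vectors supported on the \<open>n + 1\<close> indices \<open>{..n}\<close>,
  where \<open>a\<close> is at least \<open>a n\<close>.\<close>

lemma decreasing_rearrangement_antimono:
  fixes a :: "nat \<Rightarrow> real"
  assumes "antimono a" and M: "\<And>i. \<bar>a i\<bar> \<le> M"
  shows "decreasing_rearrangement a n = a n"
  unfolding decreasing_rearrangement_def
proof (rule antisym)
  have inf: "infinite_cdim TYPE(nat ell2)"
    using orthonormal_ell2_unit by (intro infinite_cdimI) blast
  have "0 \<le> M"
    using M[of 0] by linarith
  have "\<bar>Re (cinner (diag_op a x) x)\<bar> \<le> M" if "norm x = 1" for x
  proof -
    have "a i \<le> M" "- M \<le> a i" for i
      using M[of i] by linarith+
    then show ?thesis
      using diag_op_form_le[of a M "\<lambda>_. M" M x] diag_op_form_le[of "\<lambda>_. - M" M a M x] M \<open>0 \<le> M\<close>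
      by (simp add: diag_op_const_form that)
  qed
  then have bd: "bounded_form (diag_op a)"
    unfolding bounded_form_def by blast
  show "spectral_scale (diag_op a) (int (Suc n)) \<le> a n"
  proof (rule spectral_scale_le[OF inf bd])
    show "has_cdim (complex_vector.span (ell2_unit ` {..<n})) n"
      using orthonormal_has_cdim[OF orthonormal_ell2_unit, of "{..<n}"] by simp
    fix x :: "nat ell2"
    assume x: "x \<in> corthogonal (complex_vector.span (ell2_unit ` {..<n}))" "norm x = 1"
    have "n \<le> i" if "Rep_ell2 x i \<noteq> 0" for i
      using that x(1) by (force simp: corthogonal_span cinner_ell2_unit)
    then have "Re (cinner (diag_op a x) x) \<le> Re (cinner (diag_op (\<lambda>_. a n) x) x)"
      using antimonoD[OF assms(1)] by (intro diag_op_form_le[where M = M and N = M] M) auto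
    then show "Re (cinner (diag_op a x) x) \<le> a n"
      by (simp add: diag_op_const_form x)
  qed
  show "a n \<le> spectral_scale (diag_op a) (int (Suc n))"
  proof (rule spectral_scale_ge[OF inf bd])
    fix S :: "nat ell2 set"
    assume "has_cdim S n"
    then obtain E where E: "finite E" "card E = n" "corthogonal S = {x. \<forall>e\<in>E. cinner x e = 0}"
      by (rule has_cdim_corthogonalE)
    obtain x where x: "x \<in> complex_vector.span (ell2_unit ` {..n})" "norm x = 1"
      "\<forall>e\<in>E. cinner x e = 0"
    proof (rule unit_vector_in_span_orthogonal[of "ell2_unit ` {..n}" E])
      show "card E < card (ell2_unit ` {..n} :: nat ell2 set)"
        using card_image[OF orthonormal_inj_on[OF orthonormal_ell2_unit, of "{..n}"]] E(2) by simp
    qed (use orthonormal_independent[OF orthonormal_ell2_unit] E in auto)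
    have "i \<le> n" if "Rep_ell2 x i \<noteq> 0" for i
    proof (rule ccontr)
      assume "\<not> i \<le> n"
      then have "\<forall>e\<in>ell2_unit ` {..n}. cinner (ell2_unit i) e = 0"
        by (auto simp: cinner_ell2_unit Rep_ell2_unit)
      then have "cinner (ell2_unit i) x = 0"
        using cinner_span_eq_zero x(1) by blast
      then show False
        using that cinner_eq_zero_commute cinner_ell2_unit by metis
    qed
    then have "Re (cinner (diag_op (\<lambda>_. a n) x) x) \<le> Re (cinner (diag_op a x) x)"
      using antimonoD[OF assms(1)] by (intro diag_op_form_le[where M = M and N = M] M) auto
    then show "\<exists>x\<in>corthogonal S. norm x = 1 \<and> a n \<le> Re (cinner (diag_op a x) x)"
      using x E(3) by (auto simp: diag_op_const_form)
  qed
qed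


section \<open>Adjoints\<close>

lemma quadratic_nonneg_linear_coeff_zero:
  fixes b c :: real
  assumes "\<And>t. 0 \<le> 2 * t * b + t\<^sup>2 * c"
  shows "b = 0"
proof -
  have "0 \<le> c"
    using assms[of 1] assms[of "-1"] by simp
  then have c: "0 < c + 1" by simp
  \<comment> \<open>\<open>- s\<close> is close to the minimizer of the quadratic; the denominator
    \<open>c + 1\<close> also covers \<open>c = 0\<close>.\<close>
  define s where "s = b / (c + 1)"
  have b: "b = s * (c + 1)"
    using c by (simp add: s_def)
  have "0 \<le> 2 * (- s) * b + (- s)\<^sup>2 * c"
    by (rule assms)
  also have "\<dots> = - (s\<^sup>2 * (c + 2))"
    unfolding b by (simp add: algebra_simps power2_eq_square)
  finally have "s\<^sup>2 * (c + 2) \<le> 0" by simp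
  then have "s = 0"
    using \<open>0 \<le> c\<close> by (auto simp: mult_le_0_iff)
  then show ?thesis
    unfolding b by simp
qed

text \<open>The representing vector is the minimizer of \<open>\<parallel>x\<parallel>\<^sup>2 - 2 f x\<close>; minimizing sequences are Cauchy by
  the parallelogram law.\<close>

lemma Riesz_representation:
  fixes f :: "'a::{real_inner, complete_space} \<Rightarrow> real"
  assumes "bounded_linear f"
  shows "\<exists>y. \<forall>x. f x = inner x y"
proof -
  interpret f: bounded_linear f by (rule assms)
  obtain K where K: "\<And>x. \<bar>f x\<bar> \<le> norm x * K"
    using f.bounded by auto
  define J where "J x = (norm x)\<^sup>2 - 2 * f x" for x
  have "- K\<^sup>2 \<le> J x" for x
  proof -
    have "0 \<le> (norm x - K)\<^sup>2" by simp
    then show ?thesis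
      using K[of x] unfolding J_def power2_diff by linarith
  qed
  then have bdd: "bdd_below (range J)"
    by (intro bdd_belowI2[of _ "- K\<^sup>2"])
  define m where "m = Inf (range J)"
  have m: "m \<le> J x" for x
    unfolding m_def using bdd by (intro cInf_lower) auto
  have "\<exists>x. J x < m + inverse (real (Suc n))" for n
    using cInf_lessD[of "range J" "m + inverse (real (Suc n))"] unfolding m_def
    by (metis empty_not_UNIV image_is_empty inverse_positive_iff_positive less_add_same_cancel1
        of_nat_0_less_iff rangeE zero_less_Suc)
  then obtain X where X: "\<And>n. J (X n) < m + inverse (real (Suc n))"
    by metis
  have par: "(norm (x - y))\<^sup>2 \<le> 2 * (J x + J y - 2 * m)" for x y
  proof -
    have "(norm (x - y))\<^sup>2 = 2 * (J x + J y - 2 * J ((1 / 2) *\<^sub>R (x + y)))"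
      unfolding J_def power2_norm_eq_inner
      by (simp add: f.scaleR f.add inner_add_left inner_add_right inner_diff_left inner_diff_right
          inner_commute algebra_simps)
    also have "\<dots> \<le> 2 * (J x + J y - 2 * m)"
      using m[of "(1 / 2) *\<^sub>R (x + y)"] by (intro mult_left_mono diff_left_mono) auto
    finally show ?thesis .
  qed
  have "Cauchy X"
  proof (rule metric_CauchyI)
    fix e :: real assume "0 < e"
    \<comment> \<open>With both values of \<open>J\<close> within \<open>e\<^sup>2 / 4\<close> of
      \<open>m\<close>, the bound \<open>par\<close> gives a squared distance below
      \<open>e\<^sup>2\<close>.\<close>
    then obtain N where N: "inverse (real (Suc N)) < e\<^sup>2 / 4"
      using reals_Archimedean[of "e\<^sup>2 / 4"] by auto
    have small: "J (X n) < m + e\<^sup>2 / 4" if "n \<ge> N" for n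
    proof -
      have "inverse (real (Suc n)) \<le> inverse (real (Suc N))"
        using that by (simp add: le_imp_inverse_le)
      then show ?thesis
        using X[of n] N by linarith
    qed
    have "dist (X k) (X n) < e" if "k \<ge> N" "n \<ge> N" for k n
    proof -
      have "(norm (X k - X n))\<^sup>2 < e\<^sup>2"
        using par[of "X k" "X n"] small[OF that(1)] small[OF that(2)] by argo
      then show ?thesis
        using \<open>0 < e\<close> by (auto simp: dist_norm intro: power2_less_imp_less)
    qed
    then show "\<exists>N. \<forall>k\<ge>N. \<forall>n\<ge>N. dist (X k) (X n) < e" by blast
  qed
  then obtain y where y: "X \<longlonglongrightarrow> y"
    using Cauchy_convergent convergent_def by blast
  have "(\<lambda>n. J (X n)) \<longlonglongrightarrow> J y"
    unfolding J_def by (intro tendsto_intros f.tendsto y)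
  moreover have "(\<lambda>n. J (X n)) \<longlonglongrightarrow> m"
  proof (rule tendsto_sandwich[of "\<lambda>_. m" _ _ "\<lambda>n. m + inverse (real (Suc n))"])
    show "\<forall>\<^sub>F n in sequentially. m \<le> J (X n)"
      using m by simp
    show "\<forall>\<^sub>F n in sequentially. J (X n) \<le> m + inverse (real (Suc n))"
      by (intro always_eventually allI less_imp_le X)
  qed (rule tendsto_const LIMSEQ_inverse_real_of_nat_add)+
  ultimately have Jy: "J y = m"
    using LIMSEQ_unique by blast
  \<comment> \<open>First variation: the increment of \<open>J\<close> at its minimizer
    \<open>y\<close> in direction \<open>x\<close> is a nonnegative quadratic in \<open>t\<close>,
    so its linear coefficient vanishes.\<close>
  have "inner x y - f x = 0" for x
  proof (rule quadratic_nonneg_linear_coeff_zero)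
    fix t
    have "J (y + t *\<^sub>R x) = J y + (2 * t * (inner x y - f x) + t\<^sup>2 * (norm x)\<^sup>2)"
      unfolding J_def power2_norm_eq_inner
      by (simp add: f.scaleR f.add inner_add_left inner_add_right inner_commute algebra_simps
          power2_eq_square)
    then show "0 \<le> 2 * t * (inner x y - f x) + t\<^sup>2 * (norm x)\<^sup>2"
      using m[of "y + t *\<^sub>R x"] Jy by linarith
  qed
  then show ?thesis
    by (intro exI[of _ y]) simp
qed

lemma bounded_clinearI:
  assumes "\<And>x y. T (x + y) = T x + T y" "\<And>c x. T (c *\<^sub>C x) = c *\<^sub>C T x"
    and "\<And>x. norm (T x) \<le> norm x * M"
  shows "bounded_clinear T"
  unfolding bounded_clinear_def
  using assms by (auto intro!: bounded_linear_intro[of T M] simp flip: scaleC_of_real)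

text \<open>Real Riesz representation gives the identity for real parts; applying it to
  \<open>(- \<i>) *\<^sub>C x\<close> gives the imaginary parts. Uniqueness of the representing
  vector then justifies the \<open>THE\<close> in \<open>cadjoint\<close>.\<close>

lemma cinner_cadjoint:
  fixes T :: "'a::chilbert \<Rightarrow> 'b::chilbert"
  assumes "bounded_clinear T"
  shows "cinner (T x) y = cinner x (cadjoint T y)"
proof -
  have "\<exists>z. \<forall>x. inner (T x) y = inner x z" for y
    using assms unfolding bounded_clinear_def
    by (intro Riesz_representation bounded_linear_compose[OF bounded_linear_inner_left]) auto
  then obtain G where G: "\<And>x y. inner (T x) y = inner x (G y)"
    by metis
  have G': "cinner (T x) y = cinner x (G y)" for x y
  proof (rule complex_eqI)
    show "Re (cinner (T x) y) = Re (cinner x (G y))"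
      by (simp add: Re_cinner G)
    show "Im (cinner (T x) y) = Im (cinner x (G y))"
      unfolding Im_cinner bounded_clinear_scaleC[OF assms, symmetric] by (simp only: Re_cinner G)
  qed
  have "\<forall>x y. cinner (T x) y = cinner x (cadjoint T y)"
    unfolding cadjoint_def
  proof (rule theI[of _ G])
    show "\<forall>x y. cinner (T x) y = cinner x (G y)"
      using G' by blast
    show "H = G" if "\<forall>x y. cinner (T x) y = cinner x (H y)" for H
      using that G' by (intro ext cinner_eqI) metis
  qed
  then show ?thesis by blast
qed

text \<open>Test the adjoint identity at \<open>cadjoint T y\<close> and cancel its norm. Keeping
  the same \<open>M\<close> is what later makes division by \<open>M\<^sup>2\<close> the right
  normalization.\<close>

lemma norm_cadjoint_le:
  fixes T :: "'a::chilbert \<Rightarrow> 'b::chilbert"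
  assumes "bounded_clinear T" "0 < M" "\<And>x. norm (T x) \<le> norm x * M"
  shows "norm (cadjoint T y) \<le> norm y * M"
proof (cases "cadjoint T y = 0")
  case True
  then show ?thesis
    using assms(2) by simp
next
  case False
  let ?g = "cadjoint T y"
  have "(norm ?g)\<^sup>2 = Re (cinner (T ?g) y)"
    by (simp add: cinner_cadjoint[OF assms(1)] cinner_self)
  also have "\<dots> \<le> norm (T ?g) * norm y"
    unfolding Re_cinner by (rule norm_cauchy_schwarz)
  also have "\<dots> \<le> norm ?g * M * norm y"
    using assms(3) by (intro mult_right_mono) auto
  finally show ?thesis
    using False by (simp add: power2_eq_square mult_ac)
qed

lemma bounded_clinear_cadjoint:
  fixes T :: "'a::chilbert \<Rightarrow> 'b::chilbert"
  assumes "bounded_clinear T"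
  shows "bounded_clinear (cadjoint T)"
proof -
  obtain M where M: "M > 0" "\<And>x. norm (T x) \<le> norm x * M"
    using bounded_clinear_bound[OF assms] by blast
  show ?thesis
  proof (rule bounded_clinearI)
    show "cadjoint T (x + y) = cadjoint T x + cadjoint T y" for x y
      by (rule cinner_eqI) (simp add: cinner_add_right flip: cinner_cadjoint[OF assms])
    show "cadjoint T (c *\<^sub>C x) = c *\<^sub>C cadjoint T x" for c x
      by (rule cinner_eqI) (simp add: cinner_scaleC_right flip: cinner_cadjoint[OF assms])
    show "norm (cadjoint T x) \<le> norm x * M" for x
      by (rule norm_cadjoint_le[OF assms M])
  qed
qed

lemma bounded_clinear_compose:
  "bounded_clinear S \<Longrightarrow> bounded_clinear T \<Longrightarrow> bounded_clinear (S \<circ> T)"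
  unfolding bounded_clinear_def comp_def by (auto intro: bounded_linear_compose)


lemma bounded_clinear_const_scaleR:
  assumes "bounded_clinear T"
  shows "bounded_clinear (\<lambda>x. r *\<^sub>R T x)"
  unfolding bounded_clinear_def
proof (intro conjI allI)
  show "bounded_linear (\<lambda>x. r *\<^sub>R T x)"
    using assms unfolding bounded_clinear_def by (intro bounded_linear_const_scaleR) auto
  show "r *\<^sub>R T (c *\<^sub>C x) = c *\<^sub>C r *\<^sub>R T x" for c x
    by (simp add: bounded_clinear_scaleC[OF assms] scaleC_scaleC mult.commute flip: scaleC_of_real)
qed


section \<open>Positive square roots\<close>

lemma bounded_linear_cinner_left: "bounded_linear (\<lambda>x. cinner x y)"
proof (rule bounded_linear_intro)
  show "norm (cinner x y) \<le> norm x * (2 * norm y)" for x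
  proof -
    have "norm (cinner x y) \<le> \<bar>Re (cinner x y)\<bar> + \<bar>Im (cinner x y)\<bar>"
      by (rule cmod_le)
    also have "\<dots> \<le> norm x * norm y + norm ((- \<i>) *\<^sub>C x) * norm y"
      unfolding Im_cinner Re_cinner by (intro add_mono Cauchy_Schwarz_ineq2)
    finally show ?thesis
      by (simp add: norm_scaleC)
  qed
qed (simp_all add: cinner_add_left cinner_scaleR_left scaleR_conv_of_real)

lemma bounded_linear_scaleC: "bounded_linear (\<lambda>x. c *\<^sub>C x)"
  by (rule bounded_linear_intro[of _ "cmod c"])
    (simp_all add: scaleC_add_right norm_scaleC scaleC_scaleC mult.commute flip: scaleC_of_real)

text \<open>Polarization: the form is real at \<open>x + y\<close> and at
  \<open>x + \<i> *\<^sub>C y\<close>, which determines the imaginary and the real part.\<close>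

lemma positive_op_symmetric:
  assumes "positive_op P"
  shows "cinner (P x) y = cinner x (P y)"
proof -
  have P: "bounded_clinear P" "\<And>x. Im (cinner (P x) x) = 0"
    using assms by (auto simp: positive_op_def)
  note linear = bounded_clinear_add[OF P(1)] bounded_clinear_scaleC[OF P(1)]
    cinner_add_left cinner_add_right cinner_scaleC_left cinner_scaleC_right
  have "Im (cinner (P x) y) + Im (cinner (P y) x) = 0"
    using P(2)[of "x + y"] P(2)[of x] P(2)[of y] by (simp add: linear)
  moreover have "Re (cinner (P x) y) = Re (cinner (P y) x)"
    using P(2)[of "x + \<i> *\<^sub>C y"] P(2)[of x] P(2)[of y] by (simp add: linear)
  ultimately have "cinner (P x) y = cnj (cinner (P y) x)"
    by (simp add: complex_eq_iff)
  then show ?thesis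
    using cinner_commute by metis
qed

text \<open>If the form vanishes at \<open>y\<close>, then along \<open>y + t *\<^sub>R P y\<close>
  it is a nonnegative quadratic whose linear coefficient is twice the squared norm of
  \<open>P y\<close>.\<close>

lemma positive_op_eq_zero:
  assumes "positive_op P" "Re (cinner (P y) y) = 0"
  shows "P y = 0"
proof -
  have P: "bounded_clinear P" "\<And>x. 0 \<le> Re (cinner (P x) x)"
    using assms by (auto simp: positive_op_def)
  have "(norm (P y))\<^sup>2 = 0"
  proof (rule quadratic_nonneg_linear_coeff_zero)
    fix t
    have "Re (cinner (P (y + t *\<^sub>R P y)) (y + t *\<^sub>R P y)) =
        2 * t * (norm (P y))\<^sup>2 + t\<^sup>2 * Re (cinner (P (P y)) (P y))"
      using assms(2) positive_op_symmetric[OF assms(1), of "P y" y]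
      by (simp add: bounded_clinear_add[OF P(1)] bounded_clinear_scaleR[OF P(1)] cinner_add_left
          cinner_add_right cinner_scaleR_left cinner_scaleR_right cinner_self power2_eq_square
          algebra_simps)
    then show "0 \<le> 2 * t * (norm (P y))\<^sup>2 + t\<^sup>2 * Re (cinner (P (P y)) (P y))"
      using P(2) by metis
  qed
  then show ?thesis by simp
qed

text \<open>Provides completeness of the bounded operators in operator norm, where the square root
  iteration takes place.\<close>

instance chilbert \<subseteq> banach ..

text \<open>The iteration for \<open>1 - sqrt (1 - c)\<close> at the extreme value
  \<open>c = 1\<close>. Being increasing and bounded it is Cauchy, and this passes to the operators
  it dominates.\<close>

fun sqrt_majorant :: "nat \<Rightarrow> real" where
  "sqrt_majorant 0 = 0"
| "sqrt_majorant (Suc n) = (1 + (sqrt_majorant n)\<^sup>2) / 2"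

lemma sqrt_majorant_bounds: "0 \<le> sqrt_majorant n \<and> sqrt_majorant n \<le> 1"
proof (induction n)
  case (Suc n)
  then have "(sqrt_majorant n)\<^sup>2 \<le> 1"
    by (simp add: power_le_one)
  then show ?case by simp
qed simp

lemma sqrt_majorant_mono: "incseq sqrt_majorant"
  unfolding incseq_Suc_iff
proof
  fix n
  have "0 \<le> (1 - sqrt_majorant n)\<^sup>2" by simp
  then show "sqrt_majorant n \<le> sqrt_majorant (Suc n)"
    by (simp add: power2_diff)
qed

text \<open>With \<open>C = 1 - R\<close>, the equation \<open>(1 - Y)\<^sup>2 = R\<close> reads \<open>Y = (C + Y\<^sup>2) / 2\<close>. Since \<open>\<parallel>C\<parallel> \<le> 1\<close>, the
  increments of the corresponding iteration are dominated by those of the scalar iteration with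
  \<open>C = 1\<close>.\<close>

lemma positive_sqrt_exists_near_identity:
  fixes R :: "'a::chilbert \<Rightarrow> 'a"
  assumes R: "bounded_clinear R" and sym: "\<And>x y. cinner (R x) y = cinner x (R y)"
    and contr: "\<And>x. norm (x - R x) \<le> norm x"
  shows "\<exists>P. positive_op P \<and> P \<circ> P = R \<and>
    (\<forall>Q. bounded_clinear Q \<longrightarrow> Q \<circ> R = R \<circ> Q \<longrightarrow> Q \<circ> P = P \<circ> Q)"
proof -
  define C where "C = Blinfun (\<lambda>x. x - R x)"
  have "bounded_linear (\<lambda>x. x - R x)"
    using R unfolding bounded_clinear_def by (intro bounded_linear_sub bounded_linear_ident) auto
  then have C: "blinfun_apply C x = x - R x" for x
    by (simp add: C_def bounded_linear_Blinfun_apply)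
  have normC: "norm C \<le> 1"
    by (rule norm_blinfun_bound) (auto simp: C contr)
  define Y where "Y = rec_nat 0 (\<lambda>_ Z. (1 / 2) *\<^sub>R (C + (Z o\<^sub>L Z)))"
  have Y0: "Y 0 = 0" and YS: "Y (Suc n) = (1 / 2) *\<^sub>R (C + (Y n o\<^sub>L Y n))" for n
    by (simp_all add: Y_def)
  have YSx: "blinfun_apply (Y (Suc n)) x = (1 / 2) *\<^sub>R (x - R x + blinfun_apply (Y n) (blinfun_apply (Y n) x))" for n x
    by (simp add: YS C blinfun.scaleR_left blinfun.add_left)
  have normY: "norm (Y n) \<le> sqrt_majorant n" for n
  proof (induction n)
    case (Suc n)
    have "norm (Y (Suc n)) \<le> (norm C + norm (Y n o\<^sub>L Y n)) / 2"
      unfolding YS using norm_triangle_ineq[of C "Y n o\<^sub>L Y n"] by simp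
    also have "norm (Y n o\<^sub>L Y n) \<le> norm (Y n) * norm (Y n)"
      by (rule norm_blinfun_compose)
    also have "norm (Y n) * norm (Y n) \<le> (sqrt_majorant n)\<^sup>2"
      unfolding power2_eq_square using Suc.IH by (intro mult_mono) (auto simp: sqrt_majorant_bounds)
    finally show ?case
      using normC by simp
  qed (simp add: Y0)
  have step: "norm (Y (Suc n) - Y n) \<le> sqrt_majorant (Suc n) - sqrt_majorant n" for n
  proof (induction n)
    case 0
    then show ?case
      using normC by (simp add: YS Y0)
  next
    case (Suc n)
    let ?s = sqrt_majorant
    define D where "D = Y (Suc n) - Y n"
    have "Y (Suc (Suc n)) - Y (Suc n) =
        (1 / 2) *\<^sub>R (C + (Y (Suc n) o\<^sub>L Y (Suc n))) - (1 / 2) *\<^sub>R (C + (Y n o\<^sub>L Y n))"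
      by (rule arg_cong2[where f = "(-)", OF YS YS])
    \<comment> \<open>Noncommutative difference of squares: the order of the factors matters here,
      while the scalar majorant factors in the same pattern.\<close>
    also have "\<dots> = (1 / 2) *\<^sub>R ((Y (Suc n) o\<^sub>L D) + (D o\<^sub>L Y n))"
      unfolding D_def
      by (simp add: bounded_bilinear.diff_left[OF bounded_bilinear_blinfun_compose]
          bounded_bilinear.diff_right[OF bounded_bilinear_blinfun_compose]
          scaleR_diff_right scaleR_add_right)
    finally have "Y (Suc (Suc n)) - Y (Suc n) = (1 / 2) *\<^sub>R ((Y (Suc n) o\<^sub>L D) + (D o\<^sub>L Y n))" .
    then have "norm (Y (Suc (Suc n)) - Y (Suc n)) \<le> (norm (Y (Suc n) o\<^sub>L D) + norm (D o\<^sub>L Y n)) / 2"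
      using norm_triangle_ineq[of "Y (Suc n) o\<^sub>L D" "D o\<^sub>L Y n"] by simp
    also have "\<dots> \<le> (norm (Y (Suc n)) * norm D + norm D * norm (Y n)) / 2"
      by (intro divide_right_mono add_mono norm_blinfun_compose) simp
    also have "\<dots> \<le> (?s (Suc n) * (?s (Suc n) - ?s n) + (?s (Suc n) - ?s n) * ?s n) / 2"
      using Suc.IH sqrt_majorant_bounds incseq_SucD[OF sqrt_majorant_mono, of n]
      unfolding D_def
      by (intro divide_right_mono add_mono mult_mono normY) auto
    also have "\<dots> = ?s (Suc (Suc n)) - ?s (Suc n)"
    proof -
      have s2: "?s (Suc (Suc n)) = (1 + (?s (Suc n))\<^sup>2) / 2" and s1: "?s (Suc n) = (1 + (?s n)\<^sup>2) / 2"
        by simp_all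
      have "(?s (Suc n) * (?s (Suc n) - ?s n) + (?s (Suc n) - ?s n) * ?s n) / 2 =
          ((?s (Suc n))\<^sup>2 - (?s n)\<^sup>2) / 2"
        by (simp only: power2_eq_square algebra_simps) simp
      also have "\<dots> = ?s (Suc (Suc n)) - ?s (Suc n)"
        using s2 s1 by argo
      finally show ?thesis .
    qed
    finally show ?case .
  qed
  have increment: "norm (Y (n + k) - Y n) \<le> sqrt_majorant (n + k) - sqrt_majorant n" for n k
  proof (induction k)
    case (Suc k)
    have "norm (Y (n + Suc k) - Y n) \<le> norm (Y (Suc (n + k)) - Y (n + k)) + norm (Y (n + k) - Y n)"
      using norm_triangle_ineq[of "Y (Suc (n + k)) - Y (n + k)" "Y (n + k) - Y n"] by simp
    then show ?case
      using Suc.IH step[of "n + k"] by simp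
  qed simp
  have "convergent sqrt_majorant"
    using sqrt_majorant_bounds
    by (intro Bseq_mono_convergent BseqI'[of _ 1])
      (auto intro!: incseqD[OF sqrt_majorant_mono])
  then have cauchy: "Cauchy sqrt_majorant"
    by (rule convergent_Cauchy)
  have "Cauchy Y"
    unfolding Cauchy_altdef
  proof (intro allI impI)
    fix e :: real assume "0 < e"
    then obtain N where N: "\<forall>m\<ge>N. \<forall>n>m. dist (sqrt_majorant m) (sqrt_majorant n) < e"
      using cauchy unfolding Cauchy_altdef by blast
    have "dist (Y m) (Y n) < e" if "N \<le> m" "m < n" for m n
    proof -
      have "norm (Y n - Y m) \<le> sqrt_majorant n - sqrt_majorant m"
        using increment[of m "n - m"] that by simp
      also have "\<dots> < e"
        using N that by (force simp: dist_real_def)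
      finally show ?thesis
        by (simp add: dist_norm norm_minus_commute)
    qed
    then show "\<exists>N. \<forall>m\<ge>N. \<forall>n>m. dist (Y m) (Y n) < e" by blast
  qed
  then obtain L where L: "Y \<longlonglongrightarrow> L"
    using Cauchy_convergent convergent_def by blast
  have Lx: "(\<lambda>n. blinfun_apply (Y n) x) \<longlonglongrightarrow> blinfun_apply L x" for x
    by (intro blinfun.tendsto L tendsto_const)
  have "(\<lambda>n. Y (Suc n)) \<longlonglongrightarrow> (1 / 2) *\<^sub>R (C + (L o\<^sub>L L))"
    unfolding YS
    by (intro tendsto_intros L bounded_bilinear.tendsto[OF bounded_bilinear_blinfun_compose])
  then have "L = (1 / 2) *\<^sub>R (C + (L o\<^sub>L L))"
    using LIMSEQ_Suc[OF L] LIMSEQ_unique by blast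
  then have "blinfun_apply L x = blinfun_apply ((1 / 2) *\<^sub>R (C + (L o\<^sub>L L))) x" for x
    by simp
  then have fix_eq: "blinfun_apply L x = (1 / 2) *\<^sub>R (x - R x + blinfun_apply L (blinfun_apply L x))" for x
    by (simp add: C blinfun.scaleR_left blinfun.add_left)
  have normL: "norm L \<le> 1"
  proof (rule LIMSEQ_le_const2[OF tendsto_norm[OF L]])
    show "\<exists>N. \<forall>n\<ge>N. norm (Y n) \<le> 1"
      using normY sqrt_majorant_bounds order_trans by blast
  qed
  \<comment> \<open>Bounded operators of type \<open>blinfun\<close> are only real-linear. Complex
    linearity, symmetry and commutation are proved along the iteration and passed to the
    limit.\<close>
  have Y_scaleC: "blinfun_apply (Y n) (c *\<^sub>C x) = c *\<^sub>C blinfun_apply (Y n) x" for n c x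
  proof (induction n arbitrary: x)
    case (Suc n)
    show ?case
      by (simp add: YSx Suc.IH bounded_clinear_scaleC[OF R] scaleC_scaleC scaleC_add_right
          complex_vector.scale_right_diff_distrib mult.commute flip: scaleC_of_real)
  qed (simp add: Y0)
  have L_scaleC: "blinfun_apply L (c *\<^sub>C x) = c *\<^sub>C blinfun_apply L x" for c x
  proof (rule LIMSEQ_unique[OF Lx])
    show "(\<lambda>n. blinfun_apply (Y n) (c *\<^sub>C x)) \<longlonglongrightarrow> c *\<^sub>C blinfun_apply L x"
      unfolding Y_scaleC by (rule bounded_linear.tendsto[OF bounded_linear_scaleC Lx])
  qed
  have Y_sym: "cinner (blinfun_apply (Y n) x) y = cinner x (blinfun_apply (Y n) y)" for n x y
  proof (induction n arbitrary: x y)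
    case (Suc n)
    show ?case
      by (simp add: YSx Suc.IH sym cinner_scaleR_left cinner_scaleR_right cinner_add_left
          cinner_add_right cinner_diff_left cinner_diff_right)
  qed (simp add: Y0)
  have L_real: "Im (cinner (blinfun_apply L x) x) = 0" for x
  proof (rule LIMSEQ_unique)
    show "(\<lambda>n. Im (cinner (blinfun_apply (Y n) x) x)) \<longlonglongrightarrow> Im (cinner (blinfun_apply L x) x)"
      by (intro tendsto_Im bounded_linear.tendsto[OF bounded_linear_cinner_left Lx])
    have "Im (cinner (blinfun_apply (Y n) x) x) = 0" for n
      using arg_cong[OF cinner_commute[of "blinfun_apply (Y n) x" x], of Im] Y_sym[of n x x] by simp
    then show "(\<lambda>n. Im (cinner (blinfun_apply (Y n) x) x)) \<longlonglongrightarrow> 0"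
      by simp
  qed
  define P where "P x = x - blinfun_apply L x" for x
  have "positive_op P"
    unfolding positive_op_def
  proof (intro conjI allI)
    show "bounded_clinear P"
    proof (rule bounded_clinearI)
      show "norm (P x) \<le> norm x * (1 + norm L)" for x
        using norm_triangle_ineq4[of x "blinfun_apply L x"] norm_blinfun[of L x]
        by (simp add: P_def algebra_simps)
    qed (simp_all add: P_def blinfun.add_right L_scaleC complex_vector.scale_right_diff_distrib)
    fix x
    show "Im (cinner (P x) x) = 0"
      by (simp add: P_def cinner_diff_left L_real cinner_self)
    have "Re (cinner (blinfun_apply L x) x) \<le> norm (blinfun_apply L x) * norm x"
      unfolding Re_cinner by (rule norm_cauchy_schwarz)
    also have "norm (blinfun_apply L x) \<le> norm L * norm x"
      by (rule norm_blinfun)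
    also have "norm L * norm x \<le> norm x"
      using normL by (simp add: mult_left_le_one_le)
    finally show "0 \<le> Re (cinner (P x) x)"
      by (simp add: P_def cinner_diff_left cinner_self power2_eq_square mult_right_mono)
  qed
  moreover have "P \<circ> P = R"
  proof
    fix x
    have "2 *\<^sub>R blinfun_apply L x =
        2 *\<^sub>R ((1 / 2) *\<^sub>R (x - R x + blinfun_apply L (blinfun_apply L x)))"
      by (rule arg_cong[OF fix_eq])
    also have "\<dots> = x - R x + blinfun_apply L (blinfun_apply L x)"
      by simp
    finally have "2 *\<^sub>R blinfun_apply L x = x - R x + blinfun_apply L (blinfun_apply L x)" .
    then show "(P \<circ> P) x = R x"
      by (simp add: P_def blinfun.diff_right scaleR_2 algebra_simps)
  qed
  \<comment> \<open>Any square root of \<open>R\<close> commutes with \<open>R\<close>, hence with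
    this \<open>P\<close>; uniqueness will depend on it.\<close>
  moreover have "Q \<circ> P = P \<circ> Q" if Q: "bounded_clinear Q" "Q \<circ> R = R \<circ> Q" for Q
  proof
    fix x
    have QR: "Q (R x) = R (Q x)" for x
      using Q(2) by (simp add: fun_eq_iff)
    have QY: "Q (blinfun_apply (Y n) x) = blinfun_apply (Y n) (Q x)" for n x
    proof (induction n arbitrary: x)
      case (Suc n)
      show ?case
        by (simp add: YSx Suc.IH QR bounded_clinear_scaleR[OF Q(1)] bounded_clinear_add[OF Q(1)]
            bounded_clinear_diff[OF Q(1)])
    qed (simp add: Y0 bounded_clinear_zero[OF Q(1)])
    have "Q (blinfun_apply L x) = blinfun_apply L (Q x)"
    proof (rule LIMSEQ_unique[of "\<lambda>n. Q (blinfun_apply (Y n) x)"])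
      show "(\<lambda>n. Q (blinfun_apply (Y n) x)) \<longlonglongrightarrow> Q (blinfun_apply L x)"
        using Q(1) unfolding bounded_clinear_def by (auto intro: bounded_linear.tendsto Lx)
      show "(\<lambda>n. Q (blinfun_apply (Y n) x)) \<longlonglongrightarrow> blinfun_apply L (Q x)"
        unfolding QY by (rule Lx)
    qed
    then show "(Q \<circ> P) x = (P \<circ> Q) x"
      by (simp add: P_def bounded_clinear_diff[OF Q(1)])
  qed
  ultimately show ?thesis by blast
qed

text \<open>For \<open>y = P x - Q x\<close>, commutation gives \<open>P y + Q y = 0\<close>. Both
  nonnegative forms then vanish at \<open>y\<close>, so \<open>P y = Q y = 0\<close>, and by
  symmetry \<open>y\<close> is orthogonal to \<open>P x - Q x\<close>, that is to itself.\<close>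

lemma positive_sqrt_unique:
  assumes P: "positive_op P" and Q: "positive_op Q"
    and eq: "Q \<circ> Q = P \<circ> P" and comm: "Q \<circ> P = P \<circ> Q"
  shows "Q = P"
proof
  fix x
  have bP: "bounded_clinear P" and bQ: "bounded_clinear Q"
    using P Q by (simp_all add: positive_op_def)
  define y where "y = P x - Q x"
  have QQ: "Q (Q x) = P (P x)" "Q (P x) = P (Q x)"
    using eq comm by (simp_all add: fun_eq_iff)
  have "P y + Q y = 0"
    by (simp add: y_def bounded_clinear_diff[OF bP] bounded_clinear_diff[OF bQ] QQ)
  then have "cinner (P y) y + cinner (Q y) y = 0"
    by (simp flip: cinner_add_left)
  from arg_cong[OF this, of Re] have "Re (cinner (P y) y) + Re (cinner (Q y) y) = 0"
    by simp
  moreover have "0 \<le> Re (cinner (P y) y)" "0 \<le> Re (cinner (Q y) y)"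
    using P Q by (auto simp: positive_op_def)
  ultimately have "Re (cinner (P y) y) = 0" "Re (cinner (Q y) y) = 0"
    by linarith+
  then have "P y = 0" "Q y = 0"
    by (simp_all add: positive_op_eq_zero P Q)
  then have "cinner y y = 0"
    using positive_op_symmetric[OF P, of x y] positive_op_symmetric[OF Q, of x y]
    by (subst y_def) (simp add: cinner_diff_left)
  then show "Q x = P x"
    by (simp add: cinner_self y_def)
qed

text \<open>Discharges both halves of the \<open>THE\<close> in \<open>sqrt_op\<close>. Division by
  \<open>M\<^sup>2\<close> brings \<open>cadjoint T \<circ> T\<close> into the range of the
  iteration, and multiplication of the root by \<open>M\<close> undoes it.\<close>

lemma abs_op_positive_square:
  fixes T :: "'a::chilbert \<Rightarrow> 'b::chilbert"
  assumes T: "bounded_clinear T"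
  shows "positive_op (abs_op T) \<and> abs_op T \<circ> abs_op T = cadjoint T \<circ> T"
proof -
  obtain M where M: "M > 0" "\<And>x. norm (T x) \<le> norm x * M"
    using bounded_clinear_bound[OF T] by blast
  define S where "S = cadjoint T \<circ> T"
  have S: "bounded_clinear S"
    unfolding S_def by (intro bounded_clinear_compose bounded_clinear_cadjoint T)
  have S_form: "cinner (S x) y = cinner (T x) (T y)" for x y
    using cinner_cadjoint[OF T, of y "T x"] cinner_commute unfolding S_def comp_apply by metis
  define R where "R x = (1 / M\<^sup>2) *\<^sub>R S x" for x
  have R: "bounded_clinear R"
    unfolding R_def by (rule bounded_clinear_const_scaleR[OF S])
  have "\<exists>P. positive_op P \<and> P \<circ> P = R \<and>
    (\<forall>Q. bounded_clinear Q \<longrightarrow> Q \<circ> R = R \<circ> Q \<longrightarrow> Q \<circ> P = P \<circ> Q)"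
  proof (rule positive_sqrt_exists_near_identity[OF R])
    show "cinner (R x) y = cinner x (R y)" for x y
    proof -
      have "cinner (S x) y = cinner x (S y)"
        using S_form[of x y] S_form[of y x] cinner_commute by metis
      then show ?thesis
        by (simp add: R_def cinner_scaleR_left cinner_scaleR_right)
    qed
    fix x
    have "norm (S x) \<le> norm (T x) * M"
      unfolding S_def comp_apply by (rule norm_cadjoint_le[OF T M])
    then have "(norm (S x))\<^sup>2 \<le> (norm (T x) * M)\<^sup>2"
      by (intro power_mono) auto
    then have "(norm (S x))\<^sup>2 / (M\<^sup>2)\<^sup>2 \<le> (norm (T x) * M)\<^sup>2 / (M\<^sup>2)\<^sup>2"
      by (rule divide_right_mono) simp
    also have "\<dots> = (norm (T x))\<^sup>2 / M\<^sup>2"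
      using M(1) by (simp add: power2_eq_square)
    \<comment> \<open>This bounds the squared norm of \<open>R x\<close> by
      \<open>inner x (R x)\<close>, so in the expansion of the squared norm of
      \<open>x - R x\<close> the negative cross term outweighs the last one.\<close>
    finally have RS: "(norm (R x))\<^sup>2 \<le> (norm (T x))\<^sup>2 / M\<^sup>2"
      by (simp add: R_def power_divide)
    have "Re (cinner (S x) x) = (norm (T x))\<^sup>2"
      by (simp add: S_form cinner_self del: of_real_power)
    then have "inner x (R x) = (norm (T x))\<^sup>2 / M\<^sup>2"
      by (simp add: R_def Re_cinner inner_commute)
    then have "(norm (x - R x))\<^sup>2 = (norm x)\<^sup>2 - 2 * ((norm (T x))\<^sup>2 / M\<^sup>2) + (norm (R x))\<^sup>2"
      by (simp add: power2_norm_eq_inner inner_diff_left inner_diff_right inner_commute)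
    also have "\<dots> \<le> (norm x)\<^sup>2"
      using RS zero_le_divide_iff[of "(norm (T x))\<^sup>2" "M\<^sup>2"] by (smt (verit) zero_le_power2)
    finally show "norm (x - R x) \<le> norm x"
      by (rule power2_le_imp_le) simp
  qed
  then obtain P where P: "positive_op P" "P \<circ> P = R"
    "\<And>Q. bounded_clinear Q \<Longrightarrow> Q \<circ> R = R \<circ> Q \<Longrightarrow> Q \<circ> P = P \<circ> Q"
    by blast
  define P' where "P' x = M *\<^sub>R P x" for x
  have bP: "bounded_clinear P"
    using P(1) by (simp add: positive_op_def)
  have P'_pos: "positive_op P'"
    using P(1) M(1) bounded_clinear_const_scaleR[OF bP, of M] unfolding positive_op_def P'_def
    by (auto simp: cinner_scaleR_left)
  have "P (P x) = R x" for x
    using P(2) by (simp add: fun_eq_iff)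
  then have P'_sq: "P' \<circ> P' = S"
    using M(1) by (simp add: fun_eq_iff P'_def R_def bounded_clinear_scaleR[OF bP] power2_eq_square)
  have "Q = P'" if Q: "positive_op Q" "Q \<circ> Q = S" for Q
  proof (rule positive_sqrt_unique[OF P'_pos Q(1)])
    have bQ: "bounded_clinear Q"
      using Q(1) by (simp add: positive_op_def)
    show "Q \<circ> Q = P' \<circ> P'"
      using Q(2) P'_sq by simp
    have "Q (S x) = S (Q x)" for x
      unfolding Q(2)[symmetric] by simp
    then have "Q \<circ> R = R \<circ> Q"
      by (simp add: fun_eq_iff R_def bounded_clinear_scaleR[OF bQ])
    then have "Q \<circ> P = P \<circ> Q"
      by (rule P(3)[OF bQ])
    then show "Q \<circ> P' = P' \<circ> Q"
      by (simp add: fun_eq_iff P'_def bounded_clinear_scaleR[OF bQ])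
  qed
  note unique = this
  have "abs_op T = P'"
    unfolding abs_op_def sqrt_op_def S_def[symmetric]
  proof (rule the_equality)
    show "positive_op P' \<and> P' \<circ> P' = S"
      by (rule conjI[OF P'_pos P'_sq])
    show "Q = P'" if "positive_op Q \<and> Q \<circ> Q = S" for Q
      by (rule unique[OF conjunct1[OF that] conjunct2[OF that]])
  qed
  then show ?thesis
    using P'_pos P'_sq S_def by simp
qed

text \<open>Turns lower bounds for the form of the modulus into lower bounds for
  \<open>norm (T x)\<close>, so that vectors can be chosen for \<open>T\<close> itself.\<close>

lemma norm_abs_op:
  assumes T: "bounded_clinear T"
  shows "norm (abs_op T x) = norm (T x)"
proof -
  have pos: "positive_op (abs_op T)" and sq: "abs_op T (abs_op T x) = cadjoint T (T x)"
    using abs_op_positive_square[OF T] by (auto simp: fun_eq_iff)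
  have "cinner (abs_op T x) (abs_op T x) = cinner (T x) (T x)"
    using positive_op_symmetric[OF pos, of x "abs_op T x"] sq cinner_cadjoint[OF T, of x "T x"] by simp
  then have "(norm (abs_op T x))\<^sup>2 = (norm (T x))\<^sup>2"
    by (simp only: cinner_self of_real_eq_iff)
  then show ?thesis
    by simp
qed


section \<open>Eigenvalue lists\<close>

text \<open>A count function of finite support is a multiset, and a multiset has exactly one sorted
  list; \<open>rev\<close> changes the direction of the order.\<close>

lemma ex1_sorted_list_of_counts:
  fixes f :: "'a::linorder \<Rightarrow> nat"
  assumes "finite {x. 0 < f x}"
  shows "\<exists>!xs. sorted_wrt (\<ge>) xs \<and> (\<forall>x. count_list xs x = f x)"
proof (rule ex1I)
  let ?xs = "rev (sorted_list_of_multiset (Abs_multiset f))"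
  have "count_list ?xs x = f x" for x
    using assms by (simp flip: count_mset)
  moreover have "sorted_wrt (\<ge>) ?xs"
    by (simp add: sorted_wrt_rev)
  ultimately show xs: "sorted_wrt (\<ge>) ?xs \<and> (\<forall>x. count_list ?xs x = f x)"
    by blast
  fix ys assume ys: "sorted_wrt (\<ge>) ys \<and> (\<forall>x. count_list ys x = f x)"
  have "mset (rev ys) = Abs_multiset f"
    using ys assms by (intro multiset_eqI) (simp add: count_mset)
  then have "sort (rev ys) = sorted_list_of_multiset (Abs_multiset f)"
    by (metis sorted_list_of_multiset_mset)
  moreover have "sorted (rev ys)"
    using ys by (simp add: sorted_wrt_rev)
  ultimately have "rev ys = sorted_list_of_multiset (Abs_multiset f)"
    by (simp add: sorted_sort_id)
  then show "ys = ?xs"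
    by (metis rev_rev_ident)
qed

section \<open>Eigenspaces of positive operators in finite dimension\<close>

definition eigenspace :: "('a::complex_inner \<Rightarrow> 'a) \<Rightarrow> real \<Rightarrow> 'a set" where
  "eigenspace P \<mu> = {x. P x = complex_of_real \<mu> *\<^sub>C x}"

lemma mem_eigenspace: "x \<in> eigenspace P \<mu> \<longleftrightarrow> P x = complex_of_real \<mu> *\<^sub>C x"
  by (simp add: eigenspace_def)

lemma subspace_eigenspace: "bounded_clinear P \<Longrightarrow> complex_vector.subspace (eigenspace P \<mu>)"
  by (intro complex_vector.subspaceI)
    (auto simp: mem_eigenspace bounded_clinear_zero bounded_clinear_add bounded_clinear_scaleC scaleC_add_right
      scaleC_scaleC mult.commute)

lemma eigenspaces_orthogonal:
  assumes "positive_op P" "x \<in> eigenspace P \<mu>" "y \<in> eigenspace P \<nu>" "\<mu> \<noteq> \<nu>"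
  shows "cinner x y = 0"
proof -
  have "complex_of_real \<mu> * cinner x y = complex_of_real \<nu> * cinner x y"
    using positive_op_symmetric[OF assms(1), of x y] assms(2,3)
    by (simp add: mem_eigenspace cinner_scaleC_left cinner_scaleC_right)
  then show ?thesis
    using assms(4) by simp
qed

lemma not_infinite_cdim_independent_finite:
  assumes "\<not> infinite_cdim TYPE('a::complex_inner)"
  obtains d where "\<And>B :: 'a set. complex_vector.independent B \<Longrightarrow> finite B \<and> card B \<le> d"
proof -
  obtain E :: "'a set" where E: "finite E" "complex_vector.span E = UNIV"
    using assms unfolding infinite_cdim_def has_cdim_def by auto
  show ?thesis
    by (rule that[of "card E"]) (rule complex_vector.independent_span_bound[OF E(1)], auto simp: E(2))
qed

lemma eigenspace_basis:
  assumes "\<not> infinite_cdim TYPE('a::complex_inner)"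
  obtains B where "B \<subseteq> eigenspace (P :: 'a \<Rightarrow> 'a) \<mu>" "complex_vector.independent B" "finite B"
    "card B = complex_vector.dim (eigenspace P \<mu>)"
proof -
  obtain B where B: "B \<subseteq> eigenspace P \<mu>" "complex_vector.independent B"
    "card B = complex_vector.dim (eigenspace P \<mu>)"
    by (rule complex_vector.basis_exists[of "eigenspace P \<mu>"])
  show ?thesis
    by (rule that[OF B(1,2) _ B(3)])
      (rule not_infinite_cdim_independent_finite[OF assms], use B(2) in blast)
qed

text \<open>Unit eigenvectors of distinct eigenvalues are orthonormal, so their number is bounded by
  the dimension. Finite support of the multiplicities makes the description
  \<open>eigenvalue_list\<close> well defined.\<close>

lemma finite_eigenvalues:
  assumes fin: "\<not> infinite_cdim TYPE('a::chilbert)" and P: "positive_op (P :: 'a \<Rightarrow> 'a)"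
  shows "finite {\<mu>. 0 < complex_vector.dim (eigenspace P \<mu>)}" (is "finite ?M")
proof (rule ccontr)
  assume inf: "infinite ?M"
  have ex: "\<exists>w. w \<in> eigenspace P \<mu> \<and> norm w = 1" if "\<mu> \<in> ?M" for \<mu>
  proof -
    obtain B where B: "B \<subseteq> eigenspace P \<mu>" "complex_vector.independent B" "finite B"
      "card B = complex_vector.dim (eigenspace P \<mu>)"
      by (rule eigenspace_basis[OF fin, of P \<mu>])
    have "card B \<noteq> 0"
      unfolding B(4) using that by simp
    then obtain b where b: "b \<in> B"
      by (metis card.empty equals0I)
    then have "b \<noteq> 0"
      using B(2) complex_vector.dependent_zero by metis
    moreover have "sgn b \<in> eigenspace P \<mu>"
      unfolding sgn_eq_scaleC using P B(1) b
      by (intro complex_vector.subspace_scale subspace_eigenspace) (auto simp: positive_op_def)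
    ultimately show ?thesis
      by (intro exI[of _ "sgn b"]) (simp add: norm_sgn)
  qed
  define w where "w \<mu> = (SOME w. w \<in> eigenspace P \<mu> \<and> norm w = 1)" for \<mu>
  have w: "w \<mu> \<in> eigenspace P \<mu>" "norm (w \<mu>) = 1" if "\<mu> \<in> ?M" for \<mu>
    unfolding w_def using someI_ex[OF ex[OF that]] by (rule conjunct1, rule conjunct2)
  have orth: "orthonormal w ?M"
    unfolding orthonormal_def
  proof (intro ballI)
    fix \<mu> \<nu> assume M: "\<mu> \<in> ?M" "\<nu> \<in> ?M"
    show "cinner (w \<mu>) (w \<nu>) = (if \<mu> = \<nu> then 1 else 0)"
    proof (cases "\<mu> = \<nu>")
      case True
      then show ?thesis using w(2)[OF M(1)] by (simp add: cinner_self)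
    next
      case False
      then show ?thesis using eigenspaces_orthogonal[OF P w(1)[OF M(1)] w(1)[OF M(2)]] by simp
    qed
  qed
  obtain d where d: "\<And>B :: 'a set. complex_vector.independent B \<Longrightarrow> finite B \<and> card B \<le> d"
    by (rule not_infinite_cdim_independent_finite[OF fin]) blast
  obtain F where F: "F \<subseteq> ?M" "finite F" "card F = Suc d"
    using infinite_arbitrarily_large[OF inf] by blast
  have wF: "orthonormal w F"
    by (rule orthonormal_subset[OF orth F(1)])
  show False
    using d[OF orthonormal_independent[OF wF F(2)]] card_image[OF orthonormal_inj_on[OF wF]] F(3)
    by simp
qed

lemma eigenvalue_list:
  assumes "\<not> infinite_cdim TYPE('a::chilbert)" "positive_op (P :: 'a \<Rightarrow> 'a)"
  shows "sorted_wrt (\<ge>) (eigenvalue_list P)"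
    and "count_list (eigenvalue_list P) \<mu> = complex_vector.dim (eigenspace P \<mu>)"
proof -
  have ex1: "\<exists>!xs. sorted_wrt (\<ge>) xs \<and>
      (\<forall>\<mu>. count_list xs \<mu> = complex_vector.dim (eigenspace P \<mu>))"
    by (intro ex1_sorted_list_of_counts finite_eigenvalues assms)
  have *: "sorted_wrt (\<ge>) (eigenvalue_list P) \<and>
      (\<forall>\<mu>. count_list (eigenvalue_list P) \<mu> = complex_vector.dim (eigenspace P \<mu>))"
    using theI'[OF ex1] unfolding eigenvalue_list_def eigenspace_def .
  show "sorted_wrt (\<ge>) (eigenvalue_list P)"
    by (rule conjunct1[OF *])
  show "count_list (eigenvalue_list P) \<mu> = complex_vector.dim (eigenspace P \<mu>)"
    by (rule spec[OF conjunct2[OF *]])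
qed

text \<open>Earlier vectors with a different eigenvalue are orthogonal automatically. Those with the
  same eigenvalue are fewer than its multiplicity, so the eigenspace has a unit vector orthogonal to
  them.\<close>

lemma eigenvalue_list_eigenvectors:
  assumes fin: "\<not> infinite_cdim TYPE('a::chilbert)" and P: "positive_op (P :: 'a \<Rightarrow> 'a)"
  defines "xs \<equiv> eigenvalue_list P"
  shows "n \<le> length xs \<Longrightarrow> \<exists>y. orthonormal y {..<n} \<and> (\<forall>i<n. y i \<in> eigenspace P (xs ! i))"
proof (induction n)
  case (Suc n)
  then obtain y where y: "orthonormal y {..<n}" "\<forall>i<n. y i \<in> eigenspace P (xs ! i)"
    by auto
  define J where "J = {j. j < n \<and> xs ! n = xs ! j}"
  have bP: "bounded_clinear P"
    using P by (simp add: positive_op_def)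
  obtain C where C: "C \<subseteq> eigenspace P (xs ! n)" "complex_vector.independent C" "finite C"
    "card C = complex_vector.dim (eigenspace P (xs ! n))"
    by (rule eigenspace_basis[OF fin, of P "xs ! n"])
  have "card (y ` J) \<le> card J"
    by (rule card_image_le) (simp add: J_def)
  \<comment> \<open>Strict because the position \<open>n\<close> itself is counted on the right and
    does not lie in \<open>J\<close>.\<close>
  also have "\<dots> < card {i. i < length xs \<and> xs ! n = xs ! i}"
  proof (rule psubset_card_mono)
    have "n < length xs"
      using Suc.prems by simp
    then have "n \<in> {i. i < length xs \<and> xs ! n = xs ! i}" "n \<notin> J"
      unfolding J_def by blast+
    moreover have "J \<subseteq> {i. i < length xs \<and> xs ! n = xs ! i}"
      unfolding J_def using less_trans[OF _ \<open>n < length xs\<close>] by blast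
    ultimately show "J \<subset> {i. i < length xs \<and> xs ! n = xs ! i}"
      by blast
  qed simp
  also have "\<dots> = count_list xs (xs ! n)"
    by (simp add: count_list_eq_length_filter length_filter_conv_card)
  also have "\<dots> = card C"
    unfolding C(4) xs_def by (rule eigenvalue_list(2)[OF fin P])
  finally have card: "card (y ` J) < card C" .
  have "finite J"
    by (simp add: J_def)
  then have "finite (y ` J)"
    by (rule finite_imageI)
  obtain v where v: "v \<in> complex_vector.span C" "norm v = 1" "\<forall>e\<in>y ` J. cinner v e = 0"
    by (rule unit_vector_in_span_orthogonal[OF C(2,3) \<open>finite (y ` J)\<close> card])
  have v_eig: "v \<in> eigenspace P (xs ! n)"
    using complex_vector.span_minimal[OF C(1) subspace_eigenspace[OF bP]] v(1) by (rule subsetD)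
  have "cinner v (y j) = 0" if "j < n" for j
  proof (cases "xs ! n = xs ! j")
    case True
    then show ?thesis
      using v(3) that by (simp add: J_def)
  next
    case False
    then show ?thesis
      using y(2) that by (intro eigenspaces_orthogonal[OF P v_eig, of _ "xs ! j"]) auto
  qed
  then have "orthonormal (y(n := v)) (insert n {..<n})"
    by (intro orthonormal_upd y(1) v(2)) auto
  then have orth: "orthonormal (y(n := v)) {..<Suc n}"
    by (simp add: lessThan_Suc)
  show ?case
    using y(2) v_eig by (intro exI[of _ "y(n := v)"] conjI orth) (auto simp: less_Suc_eq)
qed simp

text \<open>At a unit vector the form is a convex combination of the \<open>c i\<close>, weighted by
  the squared moduli of the coefficients.\<close>

lemma form_ge_on_eigenvectors:
  assumes P: "bounded_clinear P" and y: "orthonormal y I" "finite I"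
    and eig: "\<And>i. i \<in> I \<Longrightarrow> y i \<in> eigenspace P (c i)" "\<And>i. i \<in> I \<Longrightarrow> b \<le> c i"
    and v: "v \<in> complex_vector.span (y ` I)" "norm v = 1"
  shows "b \<le> Re (cinner (P v) v)"
proof -
  define a where "a i = cinner v (y i)" for i
  have v_eq: "v = (\<Sum>i\<in>I. a i *\<^sub>C y i)"
    unfolding a_def by (rule orthonormal_expansion[OF y v(1)])
  have a: "cinner (y i) v = cnj (a i)" for i
    unfolding a_def by (rule cinner_commute)
  have "cinner (P v) v = cinner (P (\<Sum>i\<in>I. a i *\<^sub>C y i)) v"
    by (rule arg_cong[OF v_eq, of "\<lambda>x. cinner (P x) v"])
  also have "\<dots> = (\<Sum>i\<in>I. complex_of_real (c i * (cmod (a i))\<^sup>2))"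
    unfolding bounded_clinear_sum[OF P] cinner_sum_left
  proof (rule sum.cong)
    fix i assume "i \<in> I"
    then have "P (y i) = complex_of_real (c i) *\<^sub>C y i"
      using eig(1) by (simp add: mem_eigenspace)
    then show "cinner (P (a i *\<^sub>C y i)) v = complex_of_real (c i * (cmod (a i))\<^sup>2)"
      by (simp add: bounded_clinear_scaleC[OF P] cinner_scaleC_left a complex_norm_square
          del: of_real_power)
  qed simp
  finally have Pv: "Re (cinner (P v) v) = (\<Sum>i\<in>I. c i * (cmod (a i))\<^sup>2)"
    by simp
  have "cinner v v = cinner (\<Sum>i\<in>I. a i *\<^sub>C y i) v"
    by (rule arg_cong[OF v_eq, of "\<lambda>x. cinner x v"])
  also have "\<dots> = (\<Sum>i\<in>I. complex_of_real ((cmod (a i))\<^sup>2))"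
    unfolding cinner_sum_left cinner_scaleC_left a complex_norm_square ..
  finally have "complex_of_real ((norm v)\<^sup>2) = complex_of_real (\<Sum>i\<in>I. (cmod (a i))\<^sup>2)"
    by (simp only: cinner_self of_real_sum)
  then have "(\<Sum>i\<in>I. (cmod (a i))\<^sup>2) = 1"
    using v(2) by (simp only: of_real_eq_iff) simp
  then have "b = (\<Sum>i\<in>I. b * (cmod (a i))\<^sup>2)"
    by (simp flip: sum_distrib_left)
  also have "\<dots> \<le> (\<Sum>i\<in>I. c i * (cmod (a i))\<^sup>2)"
    by (intro sum_mono mult_right_mono eig(2)) auto
  finally show ?thesis
    unfolding Pv .
qed


section \<open>Singular values\<close>

lemma singular_value_nonneg:
  fixes T :: "'a::chilbert \<Rightarrow> 'b::chilbert"
  assumes T: "bounded_clinear T"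
  shows "0 \<le> singular_value T n"
proof -
  have pos: "positive_op (abs_op T)"
    using abs_op_positive_square[OF T] by simp
  show ?thesis
  proof (cases "infinite_cdim TYPE('a)")
    case True
    have "0 \<le> spectral_scale (abs_op T) (int (Suc n))"
    proof (rule spectral_scale_ge[OF True])
      show "bounded_form (abs_op T)"
        using pos by (intro bounded_clinear_bounded_form) (simp add: positive_op_def)
      fix S :: "'a set" assume "has_cdim S n"
      then obtain \<psi> where \<psi>: "\<psi> \<in> corthogonal S" "norm \<psi> = 1"
        by (rule unit_vector_corthogonal[OF True])
      then show "\<exists>\<psi>\<in>corthogonal S. norm \<psi> = 1 \<and> 0 \<le> Re (cinner (abs_op T \<psi>) \<psi>)"
        using pos by (intro bexI[of _ \<psi>]) (simp_all add: positive_op_def)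
    qed
    then show ?thesis
      using True by (simp add: singular_value_def)
  next
    case False
    define xs where "xs = eigenvalue_list (abs_op T)"
    have "0 \<le> xs ! n" if n: "n < length xs"
    proof -
      obtain y where y: "orthonormal y {..<Suc n}" "\<forall>i<Suc n. y i \<in> eigenspace (abs_op T) (xs ! i)"
        using eigenvalue_list_eigenvectors[OF False pos Suc_leI[OF n[unfolded xs_def]]]
        unfolding xs_def by blast
      have "norm (y n) = 1"
        by (rule orthonormal_norm[OF y(1)]) simp
      moreover have "abs_op T (y n) = complex_of_real (xs ! n) *\<^sub>C y n"
        using y(2) by (simp add: mem_eigenspace)
      ultimately have "Re (cinner (abs_op T (y n)) (y n)) = xs ! n"
        by (simp add: cinner_scaleC_left cinner_self)
      then show ?thesis
        using pos unfolding positive_op_def by metis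
    qed
    then show ?thesis
      using False by (simp add: singular_value_def xs_def Let_def)
  qed
qed

lemma antimono_singular_value:
  fixes T :: "'a::chilbert \<Rightarrow> 'b::chilbert"
  assumes T: "bounded_clinear T"
  shows "antimono (singular_value T)"
  unfolding decseq_Suc_iff
proof
  fix n
  have pos: "positive_op (abs_op T)"
    using abs_op_positive_square[OF T] by simp
  show "singular_value T (Suc n) \<le> singular_value T n"
  proof (cases "infinite_cdim TYPE('a)")
    case True
    have "bounded_form (abs_op T)"
      using pos by (intro bounded_clinear_bounded_form) (simp add: positive_op_def)
    then show ?thesis
      using True spectral_scale_Suc_le[of "abs_op T" n] by (simp add: singular_value_def)
  next
    case False
    define xs where "xs = eigenvalue_list (abs_op T)"
    have sv: "singular_value T m = (if m < length xs then xs ! m else 0)" for m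
      using False by (simp add: singular_value_def xs_def Let_def)
    show ?thesis
    proof (cases "Suc n < length xs")
      case True
      then have "xs ! n \<ge> xs ! Suc n"
        using eigenvalue_list(1)[OF False pos] unfolding xs_def[symmetric]
        by (simp add: sorted_wrt_iff_nth_less)
      then show ?thesis
        using True by (simp add: sv)
    next
      \<comment> \<open>Past the end of the list the next value is the default 0, and monotonicity
        becomes nonnegativity.\<close>
      case False
      then show ?thesis
        using singular_value_nonneg[OF T, of n] by (simp add: sv[of "Suc n"])
    qed
  qed
qed

text \<open>A common lower-bound form of min-max for domains of finite and infinite dimension.
  Positivity of the singular value makes \<open>n\<close> a genuine list index in the finite case;
  beyond the list, no unit vector orthogonal to \<open>z\<close> need exist.\<close>

lemma singular_value_minmax:
  fixes T :: "'a::chilbert \<Rightarrow> 'b::chilbert"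
  assumes T: "bounded_clinear T" and "0 < singular_value T n" and "0 < e"
    and z: "orthonormal z {..<n}"
  shows "\<exists>\<psi>. norm \<psi> = 1 \<and> (\<forall>j<n. cinner \<psi> (z j) = 0) \<and> singular_value T n - e \<le> norm (T \<psi>)"
proof -
  have pos: "positive_op (abs_op T)"
    using abs_op_positive_square[OF T] by simp
  then have bT: "bounded_clinear (abs_op T)"
    by (simp add: positive_op_def)
  have "\<exists>\<psi>. norm \<psi> = 1 \<and> (\<forall>j<n. cinner \<psi> (z j) = 0) \<and>
      singular_value T n - e \<le> Re (cinner (abs_op T \<psi>) \<psi>)"
  proof (cases "infinite_cdim TYPE('a)")
    case True
    have dim: "has_cdim (complex_vector.span (z ` {..<n})) n"
      using orthonormal_has_cdim[OF z] by simp
    have "singular_value T n - e < spectral_scale (abs_op T) (int (Suc n))"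
      using True assms(3) by (simp add: singular_value_def)
    then obtain \<psi> where "\<psi> \<in> corthogonal (complex_vector.span (z ` {..<n}))" "norm \<psi> = 1"
      "singular_value T n - e < Re (cinner (abs_op T \<psi>) \<psi>)"
      by (rule less_spectral_scaleD[OF True bounded_clinear_bounded_form[OF bT] _ dim])
    then show ?thesis
      by (intro exI[of _ \<psi>]) (simp add: corthogonal_span)
  next
    case False
    define xs where "xs = eigenvalue_list (abs_op T)"
    have n: "n < length xs" "singular_value T n = xs ! n"
      using False assms(2) by (auto simp: singular_value_def xs_def Let_def split: if_splits)
    obtain y where y: "orthonormal y {..<Suc n}" "\<forall>i<Suc n. y i \<in> eigenspace (abs_op T) (xs ! i)"
      using eigenvalue_list_eigenvectors[OF False pos Suc_leI[OF n(1)[unfolded xs_def]]]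
      unfolding xs_def by blast
    \<comment> \<open>There are \<open>n\<close> conditions on the span of \<open>n + 1\<close>
      eigenvectors, all with eigenvalue at least \<open>xs ! n\<close>.\<close>
    have card: "card (z ` {..<n}) < card (y ` {..<Suc n})"
      using card_image_le[of "{..<n}" z] card_image[OF orthonormal_inj_on[OF y(1)]] by simp
    obtain \<psi> where \<psi>: "\<psi> \<in> complex_vector.span (y ` {..<Suc n})" "norm \<psi> = 1"
      "\<forall>e\<in>z ` {..<n}. cinner \<psi> e = 0"
      by (rule unit_vector_in_span_orthogonal[OF orthonormal_independent[OF y(1)] _ _ card]) auto
    have "xs ! n \<le> Re (cinner (abs_op T \<psi>) \<psi>)"
    proof (rule form_ge_on_eigenvectors[OF bT y(1) _ _ _ \<psi>(1,2)])
      fix i assume "i \<in> {..<Suc n}"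
      then show "y i \<in> eigenspace (abs_op T) (xs ! i)" "xs ! n \<le> xs ! i"
        using y(2) eigenvalue_list(1)[OF False pos] n(1) unfolding xs_def[symmetric]
        by (auto simp: less_Suc_eq sorted_wrt_iff_nth_less)
    qed simp
    then show ?thesis
      using \<psi>(2,3) n(2) assms(3) by (intro exI[of _ \<psi>]) auto
  qed
  then obtain \<psi> where \<psi>: "norm \<psi> = 1" "\<forall>j<n. cinner \<psi> (z j) = 0"
    "singular_value T n - e \<le> Re (cinner (abs_op T \<psi>) \<psi>)"
    by blast
  have "Re (cinner (abs_op T \<psi>) \<psi>) \<le> norm (T \<psi>)"
    using norm_cauchy_schwarz[of "abs_op T \<psi>" \<psi>] \<psi>(1) by (simp add: Re_cinner norm_abs_op[OF T])
  then show ?thesis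
    using \<psi> by (intro exI[of _ \<psi>]) auto
qed


section \<open>Nearly singular vectors\<close>

text \<open>If \<open>Re \<langle>T v, u\<rangle>\<close> is close to its supremum \<open>m\<close>, then \<open>u\<close> is nearly orthogonal to \<open>T \<psi>\<close> for
  \<open>\<psi> \<bottom> v\<close>: otherwise tilting \<open>v\<close> towards \<open>\<psi>\<close> would exceed the supremum.\<close>

lemma near_maximal_pair:
  fixes T :: "'a::complex_inner \<Rightarrow> 'b::complex_inner"
  assumes T: "bounded_clinear T" and "0 < e"
    and exF: "\<exists>y. norm y = 1 \<and> (\<forall>f\<in>F. cinner y f = 0)"
    and exE: "\<exists>x. norm x = 1 \<and> (\<forall>f\<in>E. cinner x f = 0)"
  obtains u v m where "norm u = 1" "\<forall>f\<in>E. cinner u f = 0" "norm v = 1" "\<forall>f\<in>F. cinner v f = 0"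
    "0 \<le> m" "m - e \<le> Re (cinner (T v) u)"
    "\<And>x y. norm x = 1 \<Longrightarrow> \<forall>f\<in>E. cinner x f = 0 \<Longrightarrow> norm y = 1 \<Longrightarrow> \<forall>f\<in>F. cinner y f = 0 \<Longrightarrow>
      Re (cinner (T y) x) \<le> m"
    "\<And>\<psi>. norm \<psi> = 1 \<Longrightarrow> \<forall>f\<in>insert v F. cinner \<psi> f = 0 \<Longrightarrow> cmod (cinner (T \<psi>) u) \<le> e"
proof -
  obtain M where M: "M > 0" "\<And>y. norm (T y) \<le> norm y * M"
    using bounded_clinear_bound[OF T] by blast
  define X where "X = {x. norm x = 1 \<and> (\<forall>f\<in>E. cinner x f = 0)}"
  define Y where "Y = {y. norm y = 1 \<and> (\<forall>f\<in>F. cinner y f = 0)}"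
  define R where "R = (\<lambda>(x, y). Re (cinner (T y) x)) ` (X \<times> Y)"
  obtain x0 y0 where x0: "x0 \<in> X" and y0: "y0 \<in> Y"
    using exE exF unfolding X_def Y_def by blast
  have R_le: "Re (cinner (T y) x) \<le> M" if "x \<in> X" "y \<in> Y" for x y
    using norm_cauchy_schwarz[of "T y" x] M(2)[of y] that by (simp add: X_def Y_def Re_cinner)
  have bdd: "bdd_above R"
    unfolding R_def by (rule bdd_aboveI2[of _ _ M]) (auto intro: R_le)
  have ne: "R \<noteq> {}"
    using x0 y0 by (auto simp: R_def)
  define m where "m = Sup R"
  have m_upper: "Re (cinner (T y) x) \<le> m" if "x \<in> X" "y \<in> Y" for x y
    unfolding m_def using that by (intro cSup_upper[OF _ bdd]) (auto simp: R_def)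
  have "m \<le> M"
    unfolding m_def using R_le by (intro cSup_least[OF ne]) (auto simp: R_def)
  \<comment> \<open>The admissible set is invariant under sign change, so the form takes both a
    value and its negative.\<close>
  have "0 \<le> m"
  proof -
    have "- x0 \<in> X"
      using x0 by (simp add: X_def cinner_minus_left)
    then show ?thesis
      using m_upper[OF x0 y0] m_upper[OF _ y0, of "- x0"] by (simp add: cinner_minus_right)
  qed
  \<comment> \<open>The tilting estimate gives \<open>(cmod c)\<^sup>2 \<le> d * (2 * M)\<close>,
    which this \<open>d\<close> brings below \<open>e\<^sup>2\<close>; the minimum with
    \<open>e\<close> serves the value of the pair.\<close>
  define d where "d = min e (e\<^sup>2 / (2 * M))"
  have d: "0 < d" "d \<le> e" "2 * M * d \<le> e\<^sup>2"
  proof -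
    show "0 < d" "d \<le> e"
      using \<open>0 < e\<close> M(1) by (auto simp: d_def)
    have "2 * M * d \<le> 2 * M * (e\<^sup>2 / (2 * M))"
      using M(1) by (intro mult_left_mono) (auto simp: d_def)
    then show "2 * M * d \<le> e\<^sup>2"
      using M(1) by simp
  qed
  have "\<exists>r\<in>R. m - d < r"
    using less_cSupD[OF ne, of "m - d"] d(1) unfolding m_def by auto
  then obtain u v where uv: "u \<in> X" "v \<in> Y" "m - d < Re (cinner (T v) u)"
    by (auto simp: R_def)
  have small: "cmod (cinner (T \<psi>) u) \<le> e"
    if \<psi>: "norm \<psi> = 1" "\<forall>f\<in>insert v F. cinner \<psi> f = 0" for \<psi>
  proof -
    define a where "a = Re (cinner (T v) u)"
    define c where "c = cinner (T \<psi>) u"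
    define N where "N = sqrt (a\<^sup>2 + (cmod c)\<^sup>2)"
    \<comment> \<open>Within the span of \<open>v\<close> and \<open>\<psi>\<close> this direction
      aligns both contributions: \<open>w\<close> has norm \<open>N\<close> and
      \<open>Re (cinner (T w) u) = N\<^sup>2\<close>, so normalizing \<open>w\<close> yields the
      admissible value \<open>N\<close>.\<close>
    define w where "w = a *\<^sub>R v + cnj c *\<^sub>C \<psi>"
    have v: "norm v = 1" "\<forall>f\<in>F. cinner v f = 0"
      using uv(2) by (auto simp: Y_def)
    have N2: "N\<^sup>2 = a\<^sup>2 + (cmod c)\<^sup>2"
      by (simp add: N_def)
    have "cinner v \<psi> = 0" "cinner \<psi> v = 0"
      using \<psi>(2) cinner_eq_zero_commute by auto
    moreover have "cinner v v = 1" "cinner \<psi> \<psi> = 1"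
      by (simp_all add: cinner_self v(1) \<psi>(1))
    ultimately have "cinner w w = complex_of_real (N\<^sup>2)"
      unfolding N2 w_def of_real_add complex_norm_square
      by (simp add: cinner_add_left cinner_add_right cinner_scaleR_left cinner_scaleR_right
          cinner_scaleC_left cinner_scaleC_right power2_eq_square)
    then have "(norm w)\<^sup>2 = N\<^sup>2"
      by (simp only: cinner_self of_real_eq_iff)
    then have norm_w: "norm w = N"
      by (rule power2_eq_imp_eq) (simp_all add: N_def)
    have Tw: "Re (cinner (T w) u) = N\<^sup>2"
    proof -
      have "cinner (T w) u = a * cinner (T v) u + cnj c * c"
        by (simp add: w_def c_def bounded_clinear_add[OF T] bounded_clinear_scaleR[OF T]
            bounded_clinear_scaleC[OF T] cinner_add_left cinner_scaleR_left cinner_scaleC_left)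
      moreover have "Re (cnj c * c) = (cmod c)\<^sup>2"
        unfolding cmod_power2 by (simp add: power2_eq_square)
      ultimately show ?thesis
        unfolding N2 by (simp add: a_def power2_eq_square)
    qed
    have "N \<le> m"
    proof (cases "w = 0")
      case True
      then show ?thesis
        using norm_w \<open>0 \<le> m\<close> by simp
    next
      case False
      then have "N \<noteq> 0"
        by (simp flip: norm_w)
      have "sgn w \<in> Y"
        using False v(2) \<psi>(2) unfolding Y_def
        by (auto simp: norm_sgn cinner_sgn_left)
          (simp add: w_def cinner_add_left cinner_scaleR_left cinner_scaleC_left)
      then have "Re (cinner (T (sgn w)) u) \<le> m"
        by (intro m_upper uv(1))
      moreover have "Re (cinner (T (sgn w)) u) = inverse N * Re (cinner (T w) u)"
      proof -
        have "Re (complex_of_real a * z) = a * Re z" for a z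
          by simp
        then show ?thesis
          unfolding sgn_div_norm bounded_clinear_scaleR[OF T] cinner_scaleR_left norm_w .
      qed
      ultimately show ?thesis
        using \<open>N \<noteq> 0\<close> unfolding Tw by (simp add: power2_eq_square flip: mult.assoc)
    qed
    then have "N\<^sup>2 \<le> m\<^sup>2"
      by (rule power_mono) (simp add: N_def)
    then have "(cmod c)\<^sup>2 \<le> (m - a) * (m + a)"
      unfolding N2 by (simp add: power2_eq_square algebra_simps)
    also have "\<dots> \<le> d * (2 * M)"
    proof -
      have "a \<le> m" "m - a \<le> d"
        using m_upper[OF uv(1,2)] uv(3) by (auto simp: a_def)
      then have "(m - a) * (m + a) \<le> (m - a) * (2 * M)"
        using \<open>m \<le> M\<close> by (intro mult_left_mono) auto
      also have "\<dots> \<le> d * (2 * M)"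
        using \<open>m - a \<le> d\<close> M(1) by (intro mult_right_mono) auto
      finally show ?thesis .
    qed
    also have "\<dots> \<le> e\<^sup>2"
      using d(3) by (simp add: mult_ac)
    finally show ?thesis
      unfolding c_def using \<open>0 < e\<close> by (auto intro: power2_le_imp_le)
  qed
  show ?thesis
  proof (rule that[of u v m])
    show "m - e \<le> Re (cinner (T v) u)"
      using uv(3) d(2) by linarith
  qed (use uv(1,2) \<open>0 \<le> m\<close> small m_upper in \<open>auto simp: X_def Y_def\<close>)
qed

text \<open>The second clause is the induction's memory: later test vectors are mapped almost
  orthogonally to all earlier \<open>x j\<close>. The loss at index \<open>j\<close> is
  \<open>e\<close> from the min-max vector, \<open>e\<close> from the near-maximal pair, and
  \<open>j * e\<close> from components along the earlier \<open>x\<close>; hence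
  \<open>j + 2\<close>.\<close>

lemma nearly_singular_vectors:
  fixes T :: "'a::complex_inner \<Rightarrow> 'b::complex_inner"
  assumes T: "bounded_clinear T" and inf: "infinite_cdim TYPE('b)" and e: "0 < e"
    and s: "\<And>n z. n < k \<Longrightarrow> orthonormal z {..<n} \<Longrightarrow>
      \<exists>\<psi>. norm \<psi> = 1 \<and> (\<forall>j<n. cinner \<psi> (z j) = 0) \<and> s n - e \<le> norm (T \<psi>)"
  shows "n \<le> k \<Longrightarrow> \<exists>x y. orthonormal x {..<n} \<and> orthonormal y {..<n} \<and>
      (\<forall>j<n. s j - real (j + 2) * e \<le> Re (cinner (T (y j)) (x j))) \<and>
      (\<forall>\<psi>. norm \<psi> = 1 \<longrightarrow> (\<forall>j<n. cinner \<psi> (y j) = 0) \<longrightarrow> (\<forall>j<n. cmod (cinner (T \<psi>) (x j)) \<le> e))"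
proof (induction n)
  case 0
  then show ?case by simp
next
  case (Suc n)
  then obtain x y where x: "orthonormal x {..<n}" and y: "orthonormal y {..<n}"
    and val: "\<And>j. j < n \<Longrightarrow> s j - real (j + 2) * e \<le> Re (cinner (T (y j)) (x j))"
    and small: "\<And>\<psi> j. norm \<psi> = 1 \<Longrightarrow> \<forall>j<n. cinner \<psi> (y j) = 0 \<Longrightarrow> j < n \<Longrightarrow>
      cmod (cinner (T \<psi>) (x j)) \<le> e"
    by auto
  obtain \<psi> where \<psi>: "norm \<psi> = 1" "\<forall>j<n. cinner \<psi> (y j) = 0" "s n - e \<le> norm (T \<psi>)"
    using s[OF _ y] Suc.prems by auto
  \<comment> \<open>On the domain side, which may be finite-dimensional, the min-max vector
    witnesses that the choice can continue; on the codomain side infinite dimension does.\<close>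
  have exF: "\<exists>v. norm v = 1 \<and> (\<forall>f\<in>y ` {..<n}. cinner v f = 0)"
    using \<psi> by auto
  have exE: "\<exists>u. norm u = 1 \<and> (\<forall>f\<in>x ` {..<n}. cinner u f = 0)"
    by (rule infinite_cdim_unit_orthogonal[OF inf, of "x ` {..<n}"]) auto
  obtain u v m where u: "norm u = 1" "\<forall>f\<in>x ` {..<n}. cinner u f = 0"
    and v: "norm v = 1" "\<forall>f\<in>y ` {..<n}. cinner v f = 0"
    and m: "0 \<le> m" "m - e \<le> Re (cinner (T v) u)"
      "\<And>x' y'. norm x' = 1 \<Longrightarrow> \<forall>f\<in>x ` {..<n}. cinner x' f = 0 \<Longrightarrow> norm y' = 1 \<Longrightarrow>
        \<forall>f\<in>y ` {..<n}. cinner y' f = 0 \<Longrightarrow> Re (cinner (T y') x') \<le> m"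
    and small': "\<And>\<psi>. norm \<psi> = 1 \<Longrightarrow> \<forall>f\<in>insert v (y ` {..<n}). cinner \<psi> f = 0 \<Longrightarrow>
        cmod (cinner (T \<psi>) u) \<le> e"
    by (rule near_maximal_pair[OF T e exF exE]) blast
  \<comment> \<open>Split off the projection \<open>p\<close> onto the earlier \<open>x\<close>. The
    remainder \<open>w\<close>, once normalized, is an admissible partner of \<open>\<psi>\<close>,
    so its norm is at most \<open>m\<close>; each coefficient of \<open>p\<close> is at most
    \<open>e\<close>.\<close>
  have "norm (T \<psi>) \<le> m + real n * e"
  proof -
    define p where "p = (\<Sum>j<n. cinner (T \<psi>) (x j) *\<^sub>C x j)"
    define w where "w = T \<psi> - p"
    have "cinner w (x j) = 0" if "j < n" for j
      using orthonormal_cinner_sum[OF x, of j "\<lambda>j. cinner (T \<psi>) (x j)"] that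
      by (simp add: w_def p_def cinner_diff_left)
    note w_orth = this
    have "norm w \<le> m"
    proof (cases "w = 0")
      case True
      then show ?thesis using m(1) by simp
    next
      case False
      have "cinner (x j) w = 0" if "j < n" for j
        using w_orth[OF that] cinner_eq_zero_commute by blast
      then have "cinner p w = 0"
        by (simp add: p_def cinner_sum_left cinner_scaleC_left)
      then have "cinner (T \<psi>) w = cinner w w"
        by (simp add: w_def cinner_diff_left)
      then have "Re (cinner (T \<psi>) (sgn w)) = norm w"
        using False by (simp add: sgn_div_norm cinner_scaleR_right cinner_self power2_eq_square)
      moreover have "Re (cinner (T \<psi>) (sgn w)) \<le> m"
        using False w_orth \<psi>(1,2) by (intro m(3)) (auto simp: norm_sgn cinner_sgn_left)
      ultimately show ?thesis by simp
    qed
    moreover have "norm p \<le> real n * e"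
    proof -
      have "norm p \<le> (\<Sum>j<n. norm (cinner (T \<psi>) (x j) *\<^sub>C x j))"
        unfolding p_def by (rule norm_sum)
      also have "\<dots> \<le> (\<Sum>j<n. e)"
        using small[OF \<psi>(1,2)] orthonormal_norm[OF x] by (intro sum_mono) (simp add: norm_scaleC)
      finally show ?thesis by simp
    qed
    moreover have "norm (T \<psi>) \<le> norm w + norm p"
      using norm_triangle_ineq[of w p] by (simp add: w_def)
    ultimately show ?thesis by linarith
  qed
  then have val': "s n - real (n + 2) * e \<le> Re (cinner (T v) u)"
    using \<psi>(3) m(2) by (simp add: algebra_simps)
  have "orthonormal (x(n := u)) (insert n {..<n})" "orthonormal (y(n := v)) (insert n {..<n})"
    using u v by (auto intro!: orthonormal_upd x y simp del: fun_upd_apply)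
  then have orth: "orthonormal (x(n := u)) {..<Suc n}" "orthonormal (y(n := v)) {..<Suc n}"
    by (simp_all add: lessThan_Suc)
  show ?case
    using val val' small small' by (intro exI[of _ "x(n := u)"] exI[of _ "y(n := v)"] conjI orth)
      (auto simp: less_Suc_eq)
qed

section \<open>From nearly singular vectors to the spectral spread\<close>

lemma sum_singular_values_le_sum_spread:
  fixes A :: "'h::chilbert \<times> 'k::chilbert \<Rightarrow> 'h \<times> 'k" and B :: "'k \<Rightarrow> 'h"
  assumes inf: "infinite_cdim TYPE('h)" and A: "bounded_clinear A" and A2: "bounded_clinear A2"
    and B: "bounded_clinear B" and block: "\<And>x y. A (x, y) = (A1 x + B y, cadjoint B x + A2 y)"
    and pos: "\<And>n. n < k \<Longrightarrow> 0 < singular_value B n"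
  shows "(\<Sum>n<k. 2 * singular_value B n) \<le> (\<Sum>n<k. spectral_spread A n)"
proof (rule field_le_epsilon)
  fix e :: real assume "0 < e"
  \<comment> \<open>Each of the \<open>k\<close> terms loses at most \<open>2 * (k + 2) * d\<close>
    after doubling; \<open>k + 1\<close> in place of \<open>k\<close> avoids a zero
    denominator.\<close>
  define d where "d = e / (real (k + 1) * (2 * real (k + 2)))"
  have d: "0 < d"
    using \<open>0 < e\<close> by (simp add: d_def)
  have "\<exists>x y. orthonormal x {..<k} \<and> orthonormal y {..<k} \<and>
      (\<forall>j<k. singular_value B j - real (j + 2) * d \<le> Re (cinner (B (y j)) (x j))) \<and>
      (\<forall>\<psi>. norm \<psi> = 1 \<longrightarrow> (\<forall>j<k. cinner \<psi> (y j) = 0) \<longrightarrow> (\<forall>j<k. cmod (cinner (B \<psi>) (x j)) \<le> d))"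
    by (rule nearly_singular_vectors[OF B inf d, where k = k])
      (auto intro: singular_value_minmax[OF B pos d])
  then obtain x y where x: "orthonormal x {..<k}" and y: "orthonormal y {..<k}"
    and val: "\<And>j. j < k \<Longrightarrow> singular_value B j - real (j + 2) * d \<le> Re (cinner (B (y j)) (x j))"
    by blast
  define r where "r = 1 / sqrt 2"
  have r: "complex_of_real r * complex_of_real r = 1 / 2"
    by (simp add: r_def flip: of_real_mult)
  define u where "u \<sigma> j = (r *\<^sub>R x j, (\<sigma> * r) *\<^sub>R y j)" for \<sigma> :: real and j
  have r': "complex_of_real r * (complex_of_real r * z) = z / 2" for z
    by (simp add: r flip: mult.assoc)
  have orth: "orthonormal (u \<sigma>) {..<k}" if "\<sigma> = 1 \<or> \<sigma> = - 1" for \<sigma>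
    using that x y unfolding orthonormal_def
    by (auto simp: u_def cinner_prod_def cinner_scaleR_left cinner_scaleR_right r r')
  \<comment> \<open>The diagonal blocks contribute equally for both signs and cancel. The
    off-diagonal terms change sign and are complex conjugates of each other, so their real parts
    add.\<close>
  have form: "Re (cinner (A (u 1 j)) (u 1 j)) + Re (cinner (- A (u (- 1) j)) (u (- 1) j)) =
      2 * Re (cinner (B (y j)) (x j))" for j
  proof -
    have uj: "u \<sigma> j = r *\<^sub>R (x j, \<sigma> *\<^sub>R y j)" for \<sigma>
      by (simp add: u_def mult.commute)
    have scale: "cinner (A (r *\<^sub>R p)) (r *\<^sub>R p) = cinner (A p) p / 2" for p
      unfolding bounded_clinear_scaleR[OF A] cinner_scaleR_left cinner_scaleR_right by (rule r')
    have adj: "cinner (cadjoint B (x j)) (y j) = cnj (cinner (B (y j)) (x j))"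
      using cinner_cadjoint[OF B] cinner_commute by metis
    show ?thesis
      unfolding uj cinner_minus_left scale
      by (simp add: block cinner_prod_def cinner_add_left cinner_diff_left cinner_minus_left
          cinner_minus_right bounded_clinear_minus[OF A2] bounded_clinear_minus[OF B] adj)
        (simp add: field_simps)
  qed
  have infA: "infinite_cdim TYPE('h \<times> 'k)"
    by (rule infinite_cdim_prod[OF inf])
  have "(\<Sum>n<k. 2 * singular_value B n) - e \<le> (\<Sum>n<k. 2 * Re (cinner (B (y n)) (x n)))"
  proof -
    have "(\<Sum>n<k. 2 * singular_value B n) - (\<Sum>n<k. 2 * (real (k + 2) * d)) \<le>
        (\<Sum>n<k. 2 * Re (cinner (B (y n)) (x n)))"
      unfolding sum_subtractf[symmetric]
    proof (rule sum_mono)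
      fix n assume "n \<in> {..<k}"
      then have "real (n + 2) * d \<le> real (k + 2) * d"
        using d by (intro mult_right_mono) auto
      then show "2 * singular_value B n - 2 * (real (k + 2) * d) \<le> 2 * Re (cinner (B (y n)) (x n))"
        using val[of n] \<open>n \<in> {..<k}\<close> by simp
    qed
    moreover have "(\<Sum>n<k. 2 * (real (k + 2) * d)) \<le> e"
    proof -
      have "(\<Sum>n<k. 2 * (real (k + 2) * d)) = real k * (2 * real (k + 2) * d)"
        by simp
      also have "\<dots> \<le> real (k + 1) * (2 * real (k + 2) * d)"
        using d by (intro mult_right_mono) auto
      also have "\<dots> = e"
      proof -
        have "a * (b * (e / (a * b))) = e" if "a \<noteq> 0" "b \<noteq> 0" for a b :: real
          using that by simp
        then show ?thesis
          unfolding d_def by (simp del: of_nat_add)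
      qed
      finally show ?thesis .
    qed
    ultimately show ?thesis by linarith
  qed
  also have "\<dots> = (\<Sum>n<k. Re (cinner (A (u 1 n)) (u 1 n))) +
      (\<Sum>n<k. Re (cinner (- A (u (- 1) n)) (u (- 1) n)))"
    by (simp only: form flip: sum.distrib)
  also have "\<dots> \<le> (\<Sum>n<k. spectral_scale A (int (Suc n))) +
      (\<Sum>n<k. spectral_scale (\<lambda>x. - A x) (int (Suc n)))"
    by (intro add_mono Ky_Fan_le[OF infA A orth] Ky_Fan_le[OF infA bounded_clinear_uminus[OF A] orth])
      simp_all
  also have "\<dots> = (\<Sum>n<k. spectral_spread A n)"
    by (simp only: spectral_spread_eq sum.distrib)
  finally show "(\<Sum>n<k. 2 * singular_value B n) \<le> (\<Sum>n<k. spectral_spread A n) + e"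
    by simp
qed

theorem theorem4p1:
  fixes A :: "'h::chilbert \<times> 'k::chilbert \<Rightarrow> 'h \<times> 'k"
    and A1 :: "'h \<Rightarrow> 'h" and A2 :: "'k \<Rightarrow> 'k" and B :: "'k \<Rightarrow> 'h"
  assumes "infinite_cdim TYPE('h)"
    and "separable_space (euclidean :: 'h topology)"
    and "separable_space (euclidean :: 'k topology)"
    and "selfadjoint A"
    and "bounded_clinear A1" and "bounded_clinear A2" and "bounded_clinear B"
    and "\<And>x y. A (x, y) = (A1 x + B y, cadjoint B x + A2 y)"
  shows "(\<lambda>n. 2 * singular_value B n) \<prec>\<^sub>w spectral_spread A"
proof -
  have A: "bounded_clinear A"
    using assms(4) by (simp add: selfadjoint_def)
  note infA = infinite_cdim_prod[OF assms(1), where 'b = 'k]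
  note bd = bounded_clinear_bounded_form[OF A]
  note s_nonneg = singular_value_nonneg[OF assms(7)] and s_anti = antimono_singular_value[OF assms(7)]
  \<comment> \<open>Induction serves only to strip zeros: if the last singular value vanishes, the
    left side does not grow and the right side does not shrink; otherwise monotonicity makes all of
    them positive.\<close>
  have "(\<Sum>n<k. 2 * singular_value B n) \<le> (\<Sum>n<k. spectral_spread A n)" for k
  proof (induction k)
    case (Suc k)
    show ?case
    proof (cases "singular_value B k = 0")
      case True
      then show ?thesis
        using Suc spectral_spread_nonneg[OF infA bd, of k] by simp
    next
      case False
      have "0 < singular_value B n" if "n < Suc k" for n
        using antimonoD[OF s_anti, of n k] False s_nonneg[of k] that by simp
      then show ?thesis
        by (rule sum_singular_values_le_sum_spread[OF assms(1) A assms(6,7,8)])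
    qed
  qed simp
  moreover have "decreasing_rearrangement (spectral_spread A) n = spectral_spread A n" for n
  proof (rule decreasing_rearrangement_antimono[OF antimono_spectral_spread[OF infA bd]])
    show "\<bar>spectral_spread A i\<bar> \<le> spectral_spread A 0" for i
      using antimonoD[OF antimono_spectral_spread[OF infA bd], of 0 i]
        spectral_spread_nonneg[OF infA bd, of i] by simp
  qed
  moreover have "decreasing_rearrangement (\<lambda>n. 2 * singular_value B n) n = 2 * singular_value B n" for n
  proof (rule decreasing_rearrangement_antimono)
    show "antimono (\<lambda>n. 2 * singular_value B n)"
      using s_anti by (auto simp: antimono_def)
    show "\<bar>2 * singular_value B i\<bar> \<le> 2 * singular_value B 0" for i
      using antimonoD[OF s_anti, of 0 i] s_nonneg[of i] by simp
  qed
  ultimately show ?thesis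
    by (simp add: submajorized_def)
qed

end
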